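(* Let $1<q<\infty$ and $1<\theta<\infty$. Let $g\in W^{1,1}_{loc}(\mathbb{R}^N)$ be positive and such that $\Delta_\theta g\in L^1_{loc}(\mathbb{R}^N)$ has constant sign. Then for every compactly supported $\varphi\in W^{1,\infty}(\mathbb{R}^N)$, \[ \int_{\mathbb{R}^N}|\varphi|^q\,|\Delta_\theta g|\,dx\le q^q\int_{\mathbb{R}^N}|\nabla\varphi|^q\,\frac{|\nabla g|^{q(\theta-1)}}{|\Delta_\theta g|^{q-1}}\,dx. \]
   Context: $\Delta_\theta g=\mathrm{div}\big(|\nabla g|^{\theta-2}\nabla g\big)$ is the $\theta$-Laplacian (understood in the distributional sense; the hypothesis is that this distribution is a locally integrable function of constant sign). *)

theory Defs
  imports "HOL-Analysis.Analysis"
begin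

definition partial_deriv :: "('a::euclidean_space \<Rightarrow> real) \<Rightarrow> 'a \<Rightarrow> 'a \<Rightarrow> real" where
  "partial_deriv f i x = frechet_derivative f (at x) i"

coinductive smooth_fun :: "('a::euclidean_space \<Rightarrow> real) \<Rightarrow> bool" where
  "(\<forall>x. f differentiable (at x)) \<Longrightarrow> (\<forall>i\<in>Basis. smooth_fun (partial_deriv f i))
    \<Longrightarrow> smooth_fun f"

definition test_fun :: "('a::euclidean_space \<Rightarrow> real) \<Rightarrow> bool" where
  "test_fun \<phi> \<longleftrightarrow> smooth_fun \<phi> \<and> (\<exists>K. compact K \<and> (\<forall>x. x \<notin> K \<longrightarrow> \<phi> x = 0))"

definition loc_integrable :: "('a::euclidean_space \<Rightarrow> 'b::{banach,second_countable_topology}) \<Rightarrow> bool" where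
  "loc_integrable f \<longleftrightarrow> (\<forall>K. compact K \<longrightarrow> set_integrable lebesgue K f)"

definition weak_gradient :: "('a::euclidean_space \<Rightarrow> real) \<Rightarrow> ('a \<Rightarrow> 'a) \<Rightarrow> bool" where
  "weak_gradient g G \<longleftrightarrow> loc_integrable g \<and> loc_integrable G \<and>
     (\<forall>\<phi> i. test_fun \<phi> \<longrightarrow> i \<in> Basis \<longrightarrow>
        (\<integral>x. g x * partial_deriv \<phi> i x \<partial>lebesgue) = - (\<integral>x. (G x \<bullet> i) * \<phi> x \<partial>lebesgue))"

definition W11_loc :: "('a::euclidean_space \<Rightarrow> real) \<Rightarrow> ('a \<Rightarrow> 'a) \<Rightarrow> bool" where
  "W11_loc g G \<longleftrightarrow> weak_gradient g G"

definition ess_bounded :: "('a::euclidean_space \<Rightarrow> 'b::real_normed_vector) \<Rightarrow> bool" where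
  "ess_bounded f \<longleftrightarrow> f \<in> borel_measurable lebesgue \<and> (\<exists>C. AE x in lebesgue. norm (f x) \<le> C)"

definition W1inf :: "('a::euclidean_space \<Rightarrow> real) \<Rightarrow> ('a \<Rightarrow> 'a) \<Rightarrow> bool" where
  "W1inf \<phi> \<Phi> \<longleftrightarrow> ess_bounded \<phi> \<and> ess_bounded \<Phi> \<and> weak_gradient \<phi> \<Phi>"

text \<open>The theta-Laplacian of g (with weak gradient G) is, in the sense of
  distributions, the locally integrable function h:
  div(|G|^(theta-2) G) = h, i.e.
  integral of (|G|^(theta-2) G) . grad psi = - integral of h psi for all test psi.
  The vector field |G|^(theta-2) G is required to be locally integrable so that
  the distribution is defined.\<close>
definition theta_laplacian_is :: "real \<Rightarrow> ('a::euclidean_space \<Rightarrow> 'a) \<Rightarrow> ('a \<Rightarrow> real) \<Rightarrow> bool" where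
  "theta_laplacian_is \<theta> G h \<longleftrightarrow>
     loc_integrable (\<lambda>x. (norm (G x) powr (\<theta> - 2)) *\<^sub>R G x) \<and> loc_integrable h \<and>
     (\<forall>\<psi>. test_fun \<psi> \<longrightarrow>
        (\<integral>x. (norm (G x) powr (\<theta> - 2)) * (\<Sum>i\<in>Basis. (G x \<bullet> i) * partial_deriv \<psi> i x) \<partial>lebesgue)
          = - (\<integral>x. h x * \<psi> x \<partial>lebesgue))"

end

theory Submission
  imports Defs
begin

text \<open>
  Write \<open>F = |G|\<^bsup>\<theta>-2\<^esup> G\<close>, so that \<open>div F = h\<close> weakly. Testing with \<open>|\<phi>|\<^bsup>q\<^esup>\<close> gives
  \<open>\<integral> q |\<phi>|\<^bsup>q-2\<^esup> \<phi> F \<bullet> \<Phi> = - \<integral> h |\<phi>|\<^bsup>q\<^esup>\<close>. As \<open>h\<close> has constant sign, the right-hand side is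
  \<open>\<integral> |h| |\<phi>|\<^bsup>q\<^esup>\<close> up to sign, and Young's inequality bounds the left-hand integrand by
  \<open>(1 - 1/q) |\<phi>|\<^bsup>q\<^esup> |h| + q\<^bsup>q-1\<^esup> |\<Phi>|\<^bsup>q\<^esup> |G|\<^bsup>q(\<theta>-1)\<^esup> / |h|\<^bsup>q-1\<^esup>\<close>; the first term is absorbed on the left.
  Since \<open>|\<phi>|\<^bsup>q\<^esup>\<close> is not a test function, one tests with \<open>(\<phi>\<^sub>n\<^sup>2 + n\<^bsup>-2\<^esup>)\<^bsup>q/2\<^esup> - n\<^bsup>-q\<^esup>\<close>, where \<open>\<phi>\<^sub>n\<close> is a
  mollification of \<open>\<phi>\<close>, and passes to the limit by dominated convergence along a subsequence on which
  \<open>\<phi>\<^sub>n\<close> and its gradient converge almost everywhere.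
\<close>

section \<open>Smooth functions\<close>

text \<open>Finite-order unfolding of the coinductive \<open>smooth_fun\<close>. Closure under sums,
  products and composition then becomes an induction on \<open>n\<close>, where coinduction would
  need an invariant closed under all these operations at once.\<close>

primrec Ck :: "nat \<Rightarrow> ('a::euclidean_space \<Rightarrow> real) \<Rightarrow> bool" where
  "Ck 0 f \<longleftrightarrow> True"
| "Ck (Suc n) f \<longleftrightarrow> (\<forall>x. f differentiable (at x)) \<and> (\<forall>i\<in>Basis. Ck n (partial_deriv f i))"

lemma smooth_fun_iff_Ck: "smooth_fun f \<longleftrightarrow> (\<forall>n. Ck n f)"
proof
  assume "smooth_fun f"
  then have "Ck n f" for n
    by (induction n arbitrary: f) (auto elim: smooth_fun.cases)
  then show "\<forall>n. Ck n f" by blast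
next
  assume "\<forall>n. Ck n f"
  then show "smooth_fun f"
  proof (coinduction arbitrary: f)
    case smooth_fun
    then have *: "Ck (Suc n) f" for n by blast
    from *[of 0] have "\<forall>x. f differentiable (at x)" by simp
    moreover from * have "\<forall>i\<in>Basis. \<forall>n. Ck n (partial_deriv f i)" by simp
    ultimately show ?case by blast
  qed
qed

lemma partial_deriv_eq:
  assumes "(f has_derivative f') (at x)"
  shows "partial_deriv f i x = f' i"
  using frechet_derivative_at[OF assms] by (simp add: partial_deriv_def)

lemma Ck_SucI:
  assumes "\<And>x. (f has_derivative f' x) (at x)" and "\<And>i. i \<in> Basis \<Longrightarrow> Ck n (\<lambda>x. f' x i)"
  shows "Ck (Suc n) f"
proof -
  have "partial_deriv f i = (\<lambda>x. f' x i)" for i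
    using partial_deriv_eq[OF assms(1)] by blast
  then show ?thesis
    using assms by (auto simp: differentiable_def)
qed

lemma Ck_Suc_has_derivative:
  assumes "Ck (Suc n) f"
  shows "(f has_derivative (\<lambda>v. partial_deriv f v x)) (at x)"
  using assms frechet_derivative_works[THEN iffD1, of f "at x"] by (simp add: partial_deriv_def)

lemma Ck_antimono: "Ck (Suc n) f \<Longrightarrow> Ck n f"
  by (induction n arbitrary: f) auto

lemma Ck_const: "Ck n (\<lambda>x. c)"
proof (induction n arbitrary: c)
  case (Suc n)
  show ?case by (rule Ck_SucI[where f' = "\<lambda>x v. 0"]) (use Suc in auto)
qed simp

lemma Ck_add: "Ck n f \<Longrightarrow> Ck n g \<Longrightarrow> Ck n (\<lambda>x. f x + g x)"
proof (induction n arbitrary: f g)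
  case (Suc n)
  show ?case
    by (rule Ck_SucI[OF has_derivative_add[OF Suc.prems[THEN Ck_Suc_has_derivative]]])
       (use Suc in auto)
qed simp

lemma Ck_mult: "Ck n f \<Longrightarrow> Ck n g \<Longrightarrow> Ck n (\<lambda>x. f x * g x)"
proof (induction n arbitrary: f g)
  case (Suc n)
  show ?case
    by (rule Ck_SucI[OF has_derivative_mult[OF Suc.prems[THEN Ck_Suc_has_derivative]]])
       (use Suc Suc.prems[THEN Ck_antimono] in \<open>auto intro!: Ck_add\<close>)
qed simp

lemma Ck_inner_const: "Ck n (\<lambda>x. c + x \<bullet> a)"
proof (cases n)
  case (Suc m)
  show ?thesis unfolding Suc
    by (rule Ck_SucI[where f' = "\<lambda>x v. v \<bullet> a"]) (auto intro!: derivative_eq_intros Ck_const)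
qed simp

lemma Ck_inner_self: "Ck n (\<lambda>x. x \<bullet> x)"
proof (cases n)
  case (Suc m)
  show ?thesis unfolding Suc
  proof (rule Ck_SucI[where f' = "\<lambda>x v. x \<bullet> v + v \<bullet> x"])
    show "Ck m (\<lambda>x. x \<bullet> i + i \<bullet> x)" for i :: 'a
      using Ck_add[OF Ck_inner_const[of _ 0 i] Ck_inner_const[of _ 0 i]] by (simp add: inner_commute[of i])
  qed (rule has_derivative_inner; rule has_derivative_ident)
qed simp

lemma Ck_compose_real:
  assumes "Ck (Suc n) f" and "\<And>x. (H has_real_derivative H' (f x)) (at (f x))"
    and "Ck n (\<lambda>x. H' (f x))"
  shows "Ck (Suc n) (\<lambda>x. H (f x))"
  by (rule Ck_SucI[OF DERIV_compose_FDERIV[OF assms(2) Ck_Suc_has_derivative[OF assms(1)]]])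
     (use assms in \<open>auto intro!: Ck_mult\<close>)

lemma Ck_powr:
  assumes "Ck n f" and "\<And>x. 0 < f x"
  shows "Ck n (\<lambda>x. f x powr a)"
  using assms
proof (induction n arbitrary: a)
  case (Suc n)
  show ?case
    by (rule Ck_compose_real[OF Suc.prems(1) has_real_derivative_powr[OF Suc.prems(2)]])
       (intro Ck_mult Ck_const Suc.IH Ck_antimono[OF Suc.prems(1)] Suc.prems(2))
qed simp

section \<open>A smooth function that is flat at the origin\<close>

text \<open>The span of these functions is closed under differentiation, which makes smoothness of the bump an induction.\<close>
definition flat_exp :: "nat \<Rightarrow> real \<Rightarrow> real" where
  "flat_exp k t = (if t > 0 then exp (- 1 / t) / t ^ k else 0)"

text \<open>Away from 0 this is elementary calculus; at 0 it says that \<open>exp (- 1 / t)\<close>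
  decays faster than any power of \<open>t\<close>.\<close>

lemma flat_exp_has_derivative:
  "(flat_exp k has_real_derivative flat_exp (k + 2) t - real k * flat_exp (k + 1) t) (at t)"
proof -
  consider "t > 0" | "t < 0" | "t = 0" by linarith
  then show ?thesis
  proof cases
    case 1
    have "((\<lambda>t. exp (- 1 / t) / t ^ k) has_real_derivative
        flat_exp (k + 2) t - real k * flat_exp (k + 1) t) (at t)"
    proof -
      \<comment> \<open>The power rule produces the truncated exponent \<open>k - Suc 0\<close>; for
        \<open>k = 0\<close> the factor \<open>real k\<close> makes it harmless.\<close>
      have "real k * t ^ (k - Suc 0) * t = real k * t ^ k"
        using 1 by (cases k) (auto)
      then show ?thesis
      using 1 by (auto intro!: derivative_eq_intros simp: flat_exp_def)
         (simp add: field_simps power2_eq_square power_add)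
    qed
    then show ?thesis
      by (rule DERIV_cong_ev[THEN iffD1, rotated -1, OF _ refl])
         (use eventually_nhds_in_open[of "{0<..}" t] 1 in \<open>auto elim!: eventually_mono simp: flat_exp_def\<close>)
  next
    case 2
    have "\<forall>\<^sub>F s in nhds t. 0 = flat_exp k s"
      using eventually_nhds_in_open[of "{..<0}" t] 2 by (auto elim!: eventually_mono simp: flat_exp_def)
    then have "(flat_exp k has_real_derivative 0) (at t)"
      by (rule DERIV_cong_ev[OF refl _ refl, THEN iffD1]) simp
    then show ?thesis
      using 2 by (auto simp: flat_exp_def[of _ t])
  next
    case 3
    have "((\<lambda>s. flat_exp k s / s) \<longlongrightarrow> 0) (at_right 0)"
      \<comment> \<open>Substituting the inverse of a large \<open>x\<close> for \<open>s\<close>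
        turns the difference quotient into \<open>x ^ Suc k / exp x\<close>.\<close>
      unfolding filterlim_at_right_to_top
    proof (rule Lim_transform_eventually[OF tendsto_power_div_exp_0[of "Suc k"]])
      show "\<forall>\<^sub>F x in at_top. x ^ Suc k / exp x = flat_exp k (inverse x) / inverse x"
        using eventually_gt_at_top[of 0]
        by eventually_elim (auto simp: flat_exp_def field_simps exp_minus)
    qed
    moreover have "((\<lambda>s. flat_exp k s / s) \<longlongrightarrow> 0) (at_left 0)"
      by (rule Lim_transform_eventually[OF tendsto_const])
         (auto simp: flat_exp_def eventually_at_filter)
    ultimately show ?thesis
      using 3 by (simp add: has_field_derivative_iff filterlim_split_at flat_exp_def)
  qed
qed

lemma Ck_flat_exp: "Ck n f \<Longrightarrow> Ck n (\<lambda>x. flat_exp k (f x))"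
proof (induction n arbitrary: k)
  case (Suc n)
  have "Ck n f" using Suc.prems by (rule Ck_antimono)
  then have "Ck n (\<lambda>x. flat_exp (k + 2) (f x) + (- real k) * flat_exp (k + 1) (f x))"
    using Suc.IH by (intro Ck_add Ck_mult Ck_const) auto
  then show ?case
    by (intro Ck_compose_real[OF Suc.prems flat_exp_has_derivative]) simp
qed simp

section \<open>Reflected translates and partial derivatives of test functions\<close>

lemma Ck_translate_reflect:
  "Ck n f \<Longrightarrow> Ck n (\<lambda>y. f (x - y))"
proof (induction n arbitrary: f)
  case (Suc n)
  have D: "((\<lambda>y. f (x - y)) has_derivative (\<lambda>v. - partial_deriv f v (x - y))) (at y)" for y
  proof -
    have "((\<lambda>y. f (x - y)) has_derivative (\<lambda>v. partial_deriv f (- v) (x - y))) (at y)"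
      by (rule has_derivative_compose[OF _ Ck_Suc_has_derivative[OF Suc.prems]])
         (auto intro!: derivative_eq_intros)
    then show ?thesis
      using linear_neg[OF has_derivative_linear[OF Ck_Suc_has_derivative[OF Suc.prems]]] by simp
  qed
  show ?case
    by (rule Ck_SucI[OF D])
       (use Suc Ck_mult[OF Ck_const[of _ "-1"], of n "\<lambda>y. partial_deriv f _ (x - y)"] in simp)
qed simp

lemma partial_deriv_translate_reflect:
  assumes "smooth_fun f"
  shows "partial_deriv (\<lambda>y. f (x - y)) i y = - partial_deriv f i (x - y)"
proof -
  have f: "Ck (Suc 0) f" using assms smooth_fun_iff_Ck by blast
  have "((\<lambda>y. f (x - y)) has_derivative (\<lambda>v. partial_deriv f (- v) (x - y))) (at y)"
    by (rule has_derivative_compose[OF _ Ck_Suc_has_derivative[OF f]])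
       (auto intro!: derivative_eq_intros)
  from partial_deriv_eq[OF this] show ?thesis
    using linear_neg[OF has_derivative_linear[OF Ck_Suc_has_derivative[OF f]]] by simp
qed

text \<open>These are the test functions that turn the defining identity of a weak gradient into a
  statement about convolutions.\<close>

lemma test_fun_translate_reflect:
  assumes "test_fun f" shows "test_fun (\<lambda>y. f (x - y))"
proof -
  obtain K where K: "compact K" "\<And>x. x \<notin> K \<Longrightarrow> f x = 0"
    using assms by (auto simp: test_fun_def)
  have "compact ((\<lambda>z. x - z) ` K)"
    by (intro compact_continuous_image K continuous_intros)
  moreover have "f (x - y) = 0" if "y \<notin> (\<lambda>z. x - z) ` K" for y
  proof (rule K(2), rule notI)
    assume "x - y \<in> K"
    then have "x - (x - y) \<in> (\<lambda>z. x - z) ` K" by blast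
    then show False using that by simp
  qed
  moreover have "smooth_fun (\<lambda>y. f (x - y))"
    using assms Ck_translate_reflect unfolding test_fun_def smooth_fun_iff_Ck by blast
  ultimately show ?thesis
    unfolding test_fun_def by blast
qed

lemma smooth_fun_has_derivative:
  "smooth_fun f \<Longrightarrow> (f has_derivative (\<lambda>v. partial_deriv f v x)) (at x)"
  using Ck_Suc_has_derivative smooth_fun_iff_Ck by blast

lemma smooth_fun_continuous: "smooth_fun f \<Longrightarrow> continuous_on UNIV f"
  by (meson smooth_fun_has_derivative has_derivative_continuous_on has_derivative_at_withinI)

lemma smooth_fun_partial_deriv: "smooth_fun f \<Longrightarrow> i \<in> Basis \<Longrightarrow> smooth_fun (partial_deriv f i)"
  by (erule smooth_fun.cases) auto

lemma partial_deriv_outside: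
  assumes "closed K" "\<And>x. x \<notin> K \<Longrightarrow> f x = 0" "x \<notin> K"
  shows "partial_deriv f i x = 0"
proof -
  have "(f has_derivative (\<lambda>v. 0)) (at x)"
    by (rule has_derivative_transform_within_open[of "\<lambda>x. 0" _ _ _ "- K"])
       (use assms in \<open>auto\<close>)
  then show ?thesis by (rule partial_deriv_eq)
qed

lemma test_fun_partial_deriv:
  assumes "test_fun f" "i \<in> Basis" shows "test_fun (partial_deriv f i)"
  using assms partial_deriv_outside[OF compact_imp_closed, of _ f] smooth_fun_partial_deriv[of f i]
  unfolding test_fun_def by blast

section \<open>Convolution with a test function\<close>

lemma uniformly_continuous_compact_support:
  fixes f :: "'a::euclidean_space \<Rightarrow> real"
  assumes "continuous_on UNIV f" "compact K" "\<And>x. x \<notin> K \<Longrightarrow> f x = 0"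
  shows "uniformly_continuous_on UNIV f"
proof -
  obtain R where R: "\<And>x. x \<in> K \<Longrightarrow> norm x \<le> R"
    using compact_imp_bounded[OF assms(2)] by (auto simp: bounded_iff)
  \<comment> \<open>The margin 1 ensures that two points at distance below 1 that are not both in
    this ball both have norm above \<open>R\<close>, so that \<open>f\<close> vanishes at
    both.\<close>
  have uc: "uniformly_continuous_on (cball 0 (R + 1)) f"
    by (intro compact_uniformly_continuous continuous_on_subset[OF assms(1)]) auto
  show ?thesis
    unfolding uniformly_continuous_on_def
  proof (intro allI impI)
    fix e :: real assume "e > 0"
    then obtain d where d: "d > 0"
      "\<And>x y. x \<in> cball 0 (R + 1) \<Longrightarrow> y \<in> cball 0 (R + 1) \<Longrightarrow> dist y x < d \<Longrightarrow> dist (f y) (f x) < e"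
      using uc unfolding uniformly_continuous_on_def by meson
    have "dist (f y) (f x) < e" if "dist y x < min d 1" for x y
    proof (cases "x \<in> cball 0 (R + 1) \<and> y \<in> cball 0 (R + 1)")
      case True
      then show ?thesis using d that by simp
    next
      case False
      have "norm x \<le> norm y + dist y x" "norm y \<le> norm x + dist y x"
        by (metis dist_commute dist_norm norm_triangle_sub)+
      then have "norm x > R" "norm y > R" using False that by auto
      then have "x \<notin> K" "y \<notin> K" using R by fastforce+
      then show ?thesis using assms(3) \<open>e > 0\<close> by simp
    qed
    then show "\<exists>d>0. \<forall>x\<in>UNIV. \<forall>x'\<in>UNIV. dist x' x < d \<longrightarrow> dist (f x') (f x) < e"
      using d(1) by (intro exI[of _ "min d 1"]) auto
  qed
qed

lemma test_fun_uniformly_continuous: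
  "test_fun f \<Longrightarrow> uniformly_continuous_on UNIV f"
  unfolding test_fun_def
  using uniformly_continuous_compact_support smooth_fun_continuous by blast

lemma test_fun_bounded:
  assumes "test_fun f"
  obtains B where "\<And>x. \<bar>f x\<bar> \<le> B"
proof -
  obtain K where K: "compact K" "\<And>x. x \<notin> K \<Longrightarrow> f x = 0" and "smooth_fun f"
    using assms by (auto simp: test_fun_def)
  then have "continuous_on K f"
    using smooth_fun_continuous continuous_on_subset by blast
  then have "bounded (f ` K)" using K(1) compact_continuous_image compact_imp_bounded by blast
  then obtain B where "\<And>x. x \<in> K \<Longrightarrow> \<bar>f x\<bar> \<le> B" by (auto simp: bounded_iff)
  then have "\<bar>f x\<bar> \<le> max B 0" for x using K(2) by (cases "x \<in> K") fastforce+
  then show ?thesis using that by blast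
qed

lemma partial_deriv_sum_Basis:
  assumes "smooth_fun f"
  shows "partial_deriv f v x = (\<Sum>i\<in>Basis. (v \<bullet> i) * partial_deriv f i x)"
  using Linear_Algebra.linear_componentwise[OF has_derivative_linear[OF smooth_fun_has_derivative[OF assms]], of v x 1]
  by simp

text \<open>Each of the finitely many partial derivatives is uniformly continuous, so the mean value
  inequality on a ball of fixed radius bounds the first-order remainder uniformly in
  \<open>z\<close>. Uniformity is what lets the remainder be integrated against an integrable
  function.\<close>

lemma test_fun_uniformly_differentiable:
  fixes \<rho> :: "'a::euclidean_space \<Rightarrow> real"
  assumes "test_fun \<rho>" "e > 0"
  obtains d where "d > 0"
    "\<And>z w. norm (w - z) < d \<Longrightarrow> \<bar>\<rho> w - \<rho> z - partial_deriv \<rho> (w - z) z\<bar> \<le> e * norm (w - z)"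
proof -
  \<comment> \<open>The deviations of the partial derivatives are summed over the basis, hence the
    division by the dimension.\<close>
  define c where "c = e / DIM('a)"
  have "c > 0" using assms by (simp add: c_def)
  have sm: "smooth_fun \<rho>" using assms test_fun_def by blast
  have "\<exists>d>0. \<forall>z w. norm (w - z) < d \<longrightarrow> \<bar>partial_deriv \<rho> i w - partial_deriv \<rho> i z\<bar> < c"
    if "i \<in> Basis" for i
    using test_fun_uniformly_continuous[OF test_fun_partial_deriv[OF assms(1) that]] \<open>c > 0\<close>
    unfolding uniformly_continuous_on_def dist_norm by fastforce
  then obtain D where D: "\<And>i. i \<in> Basis \<Longrightarrow> D i > 0"
    "\<And>i z w. i \<in> Basis \<Longrightarrow> norm (w - z) < D i \<Longrightarrow> \<bar>partial_deriv \<rho> i w - partial_deriv \<rho> i z\<bar> < c"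
    by metis
  define d where "d = Min (D ` Basis)"
  have "d > 0" using D(1) by (auto simp: d_def)
  have dD: "d \<le> D i" if "i \<in> Basis" for i using that by (auto simp: d_def)
  show ?thesis
  proof (rule that[OF \<open>d > 0\<close>])
    fix z w :: 'a assume zw: "norm (w - z) < d"
    have "norm (\<rho> w - \<rho> z - partial_deriv \<rho> (w - z) z) \<le> norm (w - z) * e"
    proof (rule differentiable_bound_linearization[where S = "ball z d" and f' = "\<lambda>x v. partial_deriv \<rho> v x"])
      show "z + t *\<^sub>R (w - z) \<in> ball z d" if "t \<in> {0..1}" for t
      proof -
        have "norm (t *\<^sub>R (w - z)) \<le> 1 * norm (w - z)"
          unfolding norm_scaleR using that by (intro mult_right_mono) auto
        then show ?thesis using zw by (simp add: dist_norm)
      qed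
      show "(\<rho> has_derivative (\<lambda>v. partial_deriv \<rho> v x)) (at x within ball z d)" for x
        using smooth_fun_has_derivative[OF sm] has_derivative_at_withinI by blast
      show "onorm ((\<lambda>v. partial_deriv \<rho> v x) - (\<lambda>v. partial_deriv \<rho> v z)) \<le> e" if "x \<in> ball z d" for x
      proof (rule onorm_le)
        fix v :: 'a
        have "norm (((\<lambda>v. partial_deriv \<rho> v x) - (\<lambda>v. partial_deriv \<rho> v z)) v)
            = \<bar>\<Sum>i\<in>Basis. (v \<bullet> i) * (partial_deriv \<rho> i x - partial_deriv \<rho> i z)\<bar>"
          by (simp add: partial_deriv_sum_Basis[OF sm, of v] sum_subtractf right_diff_distrib)
        also have "\<dots> \<le> (\<Sum>i\<in>Basis. \<bar>(v \<bullet> i) * (partial_deriv \<rho> i x - partial_deriv \<rho> i z)\<bar>)"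
          by (rule sum_abs)
        also have "\<dots> \<le> (\<Sum>i\<in>(Basis::'a set). norm v * c)"
        proof (rule sum_mono)
          fix i :: 'a assume i: "i \<in> Basis"
          have "norm (x - z) < D i" using that dD[OF i] by (simp add: dist_norm norm_minus_commute)
          then show "\<bar>(v \<bullet> i) * (partial_deriv \<rho> i x - partial_deriv \<rho> i z)\<bar> \<le> norm v * c"
            unfolding abs_mult using D(2)[OF i] Basis_le_norm[OF i, of v]
            by (intro mult_mono) (auto intro: less_imp_le)
        qed
        also have "\<dots> = e * norm v" by (simp add: c_def)
        finally show "norm (((\<lambda>v. partial_deriv \<rho> v x) - (\<lambda>v. partial_deriv \<rho> v z)) v) \<le> e * norm v" .
      qed
    qed (use \<open>d > 0\<close> in simp)
    then show "\<bar>\<rho> w - \<rho> z - partial_deriv \<rho> (w - z) z\<bar> \<le> e * norm (w - z)"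
      by (simp add: mult.commute)
  qed
qed

section \<open>Differentiation and support of convolutions\<close>

definition conv :: "('a::euclidean_space \<Rightarrow> real) \<Rightarrow> ('a \<Rightarrow> real) \<Rightarrow> 'a \<Rightarrow> real" where
  "conv f \<rho> x = (\<integral>y. f y * \<rho> (x - y) \<partial>lebesgue)"

lemma continuous_imp_measurable_lebesgue:
  fixes f :: "'a::euclidean_space \<Rightarrow> real"
  assumes "continuous_on UNIV f"
  shows "f \<in> borel_measurable lebesgue"
  using borel_measurable_continuous_onI[OF assms] by (intro measurable_completion) simp

lemma test_fun_translate_measurable:
  assumes "test_fun \<rho>" shows "(\<lambda>y. \<rho> (x - y)) \<in> borel_measurable lebesgue"
  using test_fun_translate_reflect[OF assms] continuous_imp_measurable_lebesgue smooth_fun_continuous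
  unfolding test_fun_def by blast

lemma conv_integrable:
  fixes f :: "'a::euclidean_space \<Rightarrow> real"
  assumes "integrable lebesgue f" "test_fun \<rho>"
  shows "integrable lebesgue (\<lambda>y. f y * \<rho> (x - y))"
proof -
  obtain B where B: "\<And>x. \<bar>\<rho> x\<bar> \<le> B" using test_fun_bounded[OF assms(2)] by blast
  show ?thesis
  proof (rule Bochner_Integration.integrable_bound)
    show "integrable lebesgue (\<lambda>y. f y * B)" using assms by simp
    show "(\<lambda>y. f y * \<rho> (x - y)) \<in> borel_measurable lebesgue"
      using test_fun_translate_measurable[OF assms(2)] assms(1) by measurable
    have "\<bar>\<rho> y\<bar> \<le> \<bar>B\<bar>" for y using B[of y] by linarith
    then show "AE y in lebesgue. norm (f y * \<rho> (x - y)) \<le> norm (f y * B)"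
      by (auto simp: abs_mult intro!: mult_left_mono)
  qed
qed

text \<open>Differentiation under the integral sign: the remainder of \<open>\<rho>\<close> is at
  most \<open>c * norm (w - x)\<close> at all points \<open>x - y\<close> simultaneously, so
  integrating it against \<open>f\<close> costs only the L1 norm of \<open>f\<close>.\<close>

lemma conv_has_derivative:
  fixes f :: "'a::euclidean_space \<Rightarrow> real"
  assumes f: "integrable lebesgue f" and \<rho>: "test_fun \<rho>"
  shows "(conv f \<rho> has_derivative (\<lambda>v. \<Sum>i\<in>Basis. (v \<bullet> i) * conv f (partial_deriv \<rho> i) x)) (at x)"
  unfolding has_derivative_at_alt
proof (intro conjI allI impI)
  show "bounded_linear (\<lambda>v. \<Sum>i\<in>Basis. (v \<bullet> i) * conv f (partial_deriv \<rho> i) x)"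
    by (intro bounded_linear_sum bounded_linear_mult_const bounded_linear_inner_left)
  fix e :: real assume "e > 0"
  define I where "I = (\<integral>y. \<bar>f y\<bar> \<partial>lebesgue)"
  have "I \<ge> 0" by (simp add: I_def)
  \<comment> \<open>\<open>I\<close> is the L1 norm of \<open>f\<close>; adding 1 avoids a division
    by zero.\<close>
  define c where "c = e / (1 + I)"
  have "c > 0" and cI: "c * I \<le> e" using \<open>e > 0\<close> \<open>I \<ge> 0\<close> by (auto simp: c_def field_simps)
  obtain d where "d > 0" and d:
    "\<And>z w. norm (w - z) < d \<Longrightarrow> \<bar>\<rho> w - \<rho> z - partial_deriv \<rho> (w - z) z\<bar> \<le> c * norm (w - z)"
    using test_fun_uniformly_differentiable[OF \<rho> \<open>c > 0\<close>] by metis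
  have sm: "smooth_fun \<rho>" using \<rho> test_fun_def by blast
  have "norm (conv f \<rho> w - conv f \<rho> x - (\<Sum>i\<in>Basis. ((w - x) \<bullet> i) * conv f (partial_deriv \<rho> i) x)) \<le> e * norm (w - x)"
    if wx: "norm (w - x) < d" for w
  proof -
    have pointwise: "f y * (\<rho> (w - y) - \<rho> (x - y) - partial_deriv \<rho> (w - x) (x - y)) =
        f y * \<rho> (w - y) - f y * \<rho> (x - y)
          - (\<Sum>i\<in>Basis. ((w - x) \<bullet> i) * (f y * partial_deriv \<rho> i (x - y)))" for y
      by (simp add: partial_deriv_sum_Basis[OF sm, of "w - x"] algebra_simps sum_distrib_left)
    note int = conv_integrable[OF f \<rho>] conv_integrable[OF f test_fun_partial_deriv[OF \<rho>]]
    have "conv f \<rho> w - conv f \<rho> x - (\<Sum>i\<in>Basis. ((w - x) \<bullet> i) * conv f (partial_deriv \<rho> i) x)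
      = (\<integral>y. f y * \<rho> (w - y) - f y * \<rho> (x - y)
          - (\<Sum>i\<in>Basis. ((w - x) \<bullet> i) * (f y * partial_deriv \<rho> i (x - y))) \<partial>lebesgue)"
      unfolding conv_def using int by simp
    also have "\<dots> = (\<integral>y. f y * (\<rho> (w - y) - \<rho> (x - y) - partial_deriv \<rho> (w - x) (x - y)) \<partial>lebesgue)"
      by (simp only: pointwise)
    finally have eq: "conv f \<rho> w - conv f \<rho> x - (\<Sum>i\<in>Basis. ((w - x) \<bullet> i) * conv f (partial_deriv \<rho> i) x) = \<dots>" .
    have le: "\<bar>f y * (\<rho> (w - y) - \<rho> (x - y) - partial_deriv \<rho> (w - x) (x - y))\<bar> \<le> \<bar>f y\<bar> * (c * norm (w - x))" for y
      unfolding abs_mult using d[of "w - y" "x - y"] wx by (intro mult_left_mono) auto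
    have "norm (\<integral>y. f y * (\<rho> (w - y) - \<rho> (x - y) - partial_deriv \<rho> (w - x) (x - y)) \<partial>lebesgue)
        \<le> (\<integral>y. \<bar>f y\<bar> * (c * norm (w - x)) \<partial>lebesgue)"
    proof (rule Bochner_Integration.integral_norm_bound_integral)
      have "integrable lebesgue (\<lambda>y. f y * \<rho> (w - y) - f y * \<rho> (x - y)
          - (\<Sum>i\<in>Basis. ((w - x) \<bullet> i) * (f y * partial_deriv \<rho> i (x - y))))"
        using int by (intro Bochner_Integration.integrable_diff Bochner_Integration.integrable_sum integrable_mult_right) auto
      then show "integrable lebesgue (\<lambda>y. f y * (\<rho> (w - y) - \<rho> (x - y) - partial_deriv \<rho> (w - x) (x - y)))"
        by (simp add: pointwise)
    qed (use f le in auto)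
    also have "\<dots> = (c * I) * norm (w - x)" by (simp add: I_def)
    also have "\<dots> \<le> e * norm (w - x)" using cI by (intro mult_right_mono) auto
    finally show ?thesis unfolding eq .
  qed
  then show "\<exists>d>0. \<forall>w. norm (w - x) < d \<longrightarrow>
      norm (conv f \<rho> w - conv f \<rho> x - (\<Sum>i\<in>Basis. ((w - x) \<bullet> i) * conv f (partial_deriv \<rho> i) x)) \<le> e * norm (w - x)"
    using \<open>d > 0\<close> by blast
qed

lemma partial_deriv_conv:
  assumes "integrable lebesgue f" "test_fun \<rho>" "i \<in> Basis"
  shows "partial_deriv (conv f \<rho>) i x = conv f (partial_deriv \<rho> i) x"
  unfolding partial_deriv_eq[OF conv_has_derivative[OF assms(1,2)]]
  using assms(3) by (simp add: inner_Basis if_distrib if_distribR sum.delta' cong: if_cong)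

text \<open>A partial derivative of the convolution is the convolution with a partial derivative of
  the kernel, which is again a test function; the induction therefore runs over all kernels.\<close>

lemma smooth_fun_conv:
  assumes "integrable lebesgue f" "test_fun \<rho>"
  shows "smooth_fun (conv f \<rho>)"
proof -
  have "Ck n (conv f \<rho>)" for n
    using assms(2)
  proof (induction n arbitrary: \<rho>)
    case (Suc n)
    have "partial_deriv (conv f \<rho>) i = conv f (partial_deriv \<rho> i)" if "i \<in> Basis" for i
      using partial_deriv_conv[OF assms(1) Suc.prems that] by blast
    then show ?case
      using conv_has_derivative[OF assms(1) Suc.prems] Suc.IH test_fun_partial_deriv[OF Suc.prems]
      by (auto simp: differentiable_def)
  qed simp
  then show ?thesis by (simp add: smooth_fun_iff_Ck)
qed

text \<open>Testing the weak gradient with the reflected translate of \<open>\<rho>\<close> moves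
  the derivative onto \<open>f\<close>; the minus sign of the integration by parts cancels the one
  from the reflection.\<close>

lemma partial_deriv_conv_weak_gradient:
  assumes "integrable lebesgue f" "weak_gradient f F" "test_fun \<rho>" "i \<in> Basis"
  shows "partial_deriv (conv f \<rho>) i x = conv (\<lambda>y. F y \<bullet> i) \<rho> x"
proof -
  have "smooth_fun \<rho>" using assms test_fun_def by blast
  have "(\<integral>y. f y * partial_deriv (\<lambda>y. \<rho> (x - y)) i y \<partial>lebesgue) = - (\<integral>y. (F y \<bullet> i) * \<rho> (x - y) \<partial>lebesgue)"
    using assms(2,4) test_fun_translate_reflect[OF assms(3)] unfolding weak_gradient_def by blast
  then show ?thesis
    using assms by (simp add: partial_deriv_conv partial_deriv_translate_reflect[OF \<open>smooth_fun \<rho>\<close>] conv_def)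
qed

text \<open>Supports add: if \<open>norm y\<close> is at most \<open>R\<close> and
  \<open>norm x\<close> exceeds \<open>R + r\<close>, then \<open>norm (x - y)\<close> exceeds
  \<open>r\<close>, so one factor of the integrand always vanishes.\<close>

lemma conv_outside:
  assumes "\<And>y. R < norm y \<Longrightarrow> f y = 0" "\<And>z. r < norm z \<Longrightarrow> \<rho> z = 0" "R + r < norm x"
  shows "conv f \<rho> x = 0"
proof -
  have "f y * \<rho> (x - y) = 0" for y
  proof (cases "R < norm y")
    case False
    then have "r < norm (x - y)" using assms(3) norm_triangle_sub[of x y] by linarith
    then show ?thesis using assms(2) by simp
  qed (use assms(1) in simp)
  then have "(\<lambda>y. f y * \<rho> (x - y)) = (\<lambda>y. 0)" by blast
  then show ?thesis by (simp add: conv_def)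
qed

section \<open>Mollifiers\<close>

text \<open>Evenness gives \<open>\<rho> (x - y)\<close> total mass 1 in either variable. Stating
  the mass as a nonnegative integral yields integrability together with the value.\<close>

definition mollifier :: "real \<Rightarrow> ('a::euclidean_space \<Rightarrow> real) \<Rightarrow> bool" where
  "mollifier r \<rho> \<longleftrightarrow> test_fun \<rho> \<and> (\<forall>z. 0 \<le> \<rho> z) \<and> (\<forall>z. \<rho> (- z) = \<rho> z) \<and>
     (\<forall>z. r < norm z \<longrightarrow> \<rho> z = 0) \<and> (\<integral>\<^sup>+z. ennreal (\<rho> z) \<partial>lebesgue) = 1"

lemma mollifier_exists:
  assumes "r > 0"
  obtains \<rho> :: "'a::euclidean_space \<Rightarrow> real" where "mollifier r \<rho>"
proof -
  \<comment> \<open>The classical bump, equal to exp(-1/(r^2 - |z|^2)) inside the ball and 0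
    outside. The difference is written as a sum with factor -1 to match the closure lemmas for
    \<open>Ck\<close>.\<close>
  define b :: "'a \<Rightarrow> real" where "b z = flat_exp 0 (r\<^sup>2 + (-1) * (z \<bullet> z))" for z
  have sm: "Ck n (\<lambda>z. c * b z)" for n c
    unfolding b_def by (intro Ck_mult Ck_const Ck_flat_exp Ck_add Ck_inner_self)
  have out: "b z = 0" if "r < norm z" for z
    using that assms power_mono[of r "norm z" 2] by (auto simp: b_def flat_exp_def power2_norm_eq_inner)
  have tf: "test_fun (\<lambda>z. c * b z)" for c
    unfolding test_fun_def
  proof (intro conjI exI allI impI)
    show "smooth_fun (\<lambda>z. c * b z)" using sm by (simp add: smooth_fun_iff_Ck)
    show "compact (cball (0::'a) r)" by simp
    show "c * b z = 0" if "z \<notin> cball 0 r" for z using out that by simp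
  qed
  have nn: "0 \<le> b z" for z by (simp add: b_def flat_exp_def)
  have b1: "b z \<le> 1" for z by (auto simp: b_def flat_exp_def)
  have meas[measurable]: "b \<in> borel_measurable lebesgue"
    using tf[of 1] continuous_imp_measurable_lebesgue smooth_fun_continuous by (auto simp: test_fun_def)
  define J where "J = (\<integral>\<^sup>+z. ennreal (b z) \<partial>lebesgue)"
  have "J \<le> (\<integral>\<^sup>+z. indicator (cball (0::'a) r) z \<partial>lebesgue)"
    unfolding J_def by (intro nn_integral_mono) (use out b1 in \<open>auto simp: indicator_def\<close>)
  also have "\<dots> < \<infinity>"
    using emeasure_bounded_finite[of "cball (0::'a) r"] by simp
  finally have "J < \<infinity>" .
  \<comment> \<open>Zero mass would force \<open>b = 0\<close> almost everywhere, but
    \<open>b\<close> is positive on the open ball, which is not a null set.\<close>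
  have "J \<noteq> 0"
  proof
    assume "J = 0"
    then have "AE z in lebesgue. b z = 0"
      unfolding J_def using nn by (subst (asm) nn_integral_0_iff_AE) (auto simp: order_antisym)
    then have "AE z in lebesgue. z \<notin> ball (0::'a) r"
    proof eventually_elim
      case (elim z)
      have "z \<bullet> z < r\<^sup>2" if "norm z < r"
        using that assms by (metis power2_norm_eq_inner norm_ge_zero power_strict_mono zero_less_numeral)
      then show ?case using elim by (auto simp: b_def flat_exp_def)
    qed
    then have "ball (0::'a) r \<in> null_sets lebesgue"
      by (subst AE_iff_null_sets) auto
    then show False
      using open_not_negligible[of "ball (0::'a) r"] assms by (simp add: negligible_iff_null_sets)
  qed
  define c where "c = 1 / enn2real J"
  have c: "c > 0" using \<open>J \<noteq> 0\<close> \<open>J < \<infinity>\<close> by (simp add: c_def enn2real_positive_iff less_top zero_less_iff_neq_zero)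
  have "(\<integral>\<^sup>+z. ennreal (c * b z) \<partial>lebesgue) = ennreal c * J"
    unfolding J_def using c by (simp add: ennreal_mult' nn_integral_cmult)
  also have "\<dots> = ennreal c * ennreal (enn2real J)"
    using \<open>J < \<infinity>\<close> by simp
  also have "\<dots> = 1"
    using c by (subst ennreal_mult''[symmetric]) (auto simp: c_def)
  finally have "mollifier r (\<lambda>z. c * b z)"
    unfolding mollifier_def using tf c nn out by (auto simp: b_def)
  then show ?thesis using that by blast
qed

lemma nn_integral_lebesgue_translate:
  fixes f :: "'a::euclidean_space \<Rightarrow> ennreal"
  assumes [measurable]: "f \<in> borel_measurable borel"
  shows "(\<integral>\<^sup>+x. f (x - y) \<partial>lebesgue) = (\<integral>\<^sup>+x. f x \<partial>lebesgue)"
proof -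
  have "(\<integral>\<^sup>+x. f x \<partial>lborel) = (\<integral>\<^sup>+x. f x \<partial>distr lborel borel ((+) (- y)))"
    by (simp add: lborel_distr_plus)
  also have "\<dots> = (\<integral>\<^sup>+x. f (x - y) \<partial>lborel)"
    by (subst nn_integral_distr) auto
  finally show ?thesis by (simp add: nn_integral_completion)
qed

lemma mollifier_measurable: "mollifier r \<rho> \<Longrightarrow> \<rho> \<in> borel_measurable borel"
  unfolding mollifier_def test_fun_def
  by (intro borel_measurable_continuous_onI smooth_fun_continuous) auto

lemma mollifier_nn_integral:
  assumes "mollifier r \<rho>"
  shows "(\<integral>\<^sup>+x. ennreal (\<rho> (x - y)) \<partial>lebesgue) = 1" "(\<integral>\<^sup>+y. ennreal (\<rho> (x - y)) \<partial>lebesgue) = 1"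
proof -
  note [measurable] = mollifier_measurable[OF assms]
  show *: "(\<integral>\<^sup>+x. ennreal (\<rho> (x - y)) \<partial>lebesgue) = 1" for y
    using assms nn_integral_lebesgue_translate[of "\<lambda>x. ennreal (\<rho> x)"] unfolding mollifier_def by simp
  have "\<rho> (x - y) = \<rho> (y - x)" for y
    using assms unfolding mollifier_def by (metis minus_diff_eq)
  then show "(\<integral>\<^sup>+y. ennreal (\<rho> (x - y)) \<partial>lebesgue) = 1"
    using *[of x] by simp
qed

lemma mollifier_has_bochner_integral:
  assumes "mollifier r \<rho>"
  shows "has_bochner_integral lebesgue (\<lambda>y. \<rho> (x - y)) 1"
  using assms mollifier_nn_integral(2)[OF assms] test_fun_translate_measurable
  unfolding mollifier_def by (intro has_bochner_integral_nn_integral) auto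

section \<open>Tonelli for the completed measure and the L1 contraction\<close>

lemma sigma_finite_lebesgue: "sigma_finite_measure (lebesgue :: 'a::euclidean_space measure)"
proof
  have "emeasure lebesgue (cball (0::'a) (real n)) \<noteq> \<infinity>" for n
    using emeasure_bounded_finite[of "cball (0::'a) (real n)"] by simp
  moreover have "\<Union> (range (\<lambda>n. cball (0::'a) (real n))) = UNIV"
    using real_arch_simple by (auto simp: dist_norm)
  ultimately show "\<exists>A. countable A \<and> A \<subseteq> sets lebesgue \<and> \<Union> A = space (lebesgue::'a measure) \<and> (\<forall>a\<in>A. emeasure lebesgue a \<noteq> \<infinity>)"
    by (intro exI[of _ "range (\<lambda>n. cball (0::'a) (real n))"]) auto
qed

lemma conv_measurable:
  assumes "integrable lebesgue f" "test_fun \<rho>"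
  shows "conv f \<rho> \<in> borel_measurable lebesgue"
  by (intro continuous_imp_measurable_lebesgue smooth_fun_continuous smooth_fun_conv assms)

text \<open>After exchanging the integrals by Tonelli, the inner integral of the kernel in
  \<open>x\<close> equals 1.\<close>

lemma conv_L1_contraction_nn:
  fixes f :: "'a::euclidean_space \<Rightarrow> real"
  assumes f: "integrable lebesgue f" and \<rho>: "mollifier r \<rho>"
  shows "(\<integral>\<^sup>+x. ennreal \<bar>conv f \<rho> x\<bar> \<partial>lebesgue) \<le> (\<integral>\<^sup>+x. ennreal \<bar>f x\<bar> \<partial>lebesgue)"
proof -
  interpret L: sigma_finite_measure "lebesgue :: 'a measure" by (rule sigma_finite_lebesgue)
  interpret P: pair_sigma_finite "lebesgue :: 'a measure" "lebesgue :: 'a measure" ..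
  note [measurable] = mollifier_measurable[OF \<rho>] borel_measurable_integrable[OF f]
  \<comment> \<open>Composing the Borel kernel with the two projections into \<open>borel\<close>
    makes \<open>\<rho> (x - y)\<close> measurable on the product of the completed spaces.\<close>
  have id[measurable]: "(\<lambda>x. x) \<in> (lebesgue :: 'a measure) \<rightarrow>\<^sub>M borel"
    by (intro measurable_completion) simp
  have [measurable]: "(\<lambda>p. fst p) \<in> (lebesgue :: 'a measure) \<Otimes>\<^sub>M (lebesgue :: 'a measure) \<rightarrow>\<^sub>M borel"
     "(\<lambda>p. snd p) \<in> (lebesgue :: 'a measure) \<Otimes>\<^sub>M (lebesgue :: 'a measure) \<rightarrow>\<^sub>M borel"
    using measurable_compose[OF measurable_fst id] measurable_compose[OF measurable_snd id] by auto
  have nn: "0 \<le> \<rho> z" and tf: "test_fun \<rho>" for z using \<rho> by (auto simp: mollifier_def)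
  have "(\<integral>\<^sup>+x. ennreal \<bar>conv f \<rho> x\<bar> \<partial>lebesgue) \<le> (\<integral>\<^sup>+x. \<integral>\<^sup>+y. ennreal \<bar>f y\<bar> * ennreal (\<rho> (x - y)) \<partial>lebesgue \<partial>lebesgue)"
  proof (rule nn_integral_mono)
    fix x
    have "ennreal \<bar>conv f \<rho> x\<bar> \<le> (\<integral>\<^sup>+y. ennreal (norm (f y * \<rho> (x - y))) \<partial>lebesgue)"
      unfolding conv_def using integral_norm_bound_ennreal[OF conv_integrable[OF f tf]] by simp
    also have "\<dots> = (\<integral>\<^sup>+y. ennreal \<bar>f y\<bar> * ennreal (\<rho> (x - y)) \<partial>lebesgue)"
      using nn by (simp add: abs_mult ennreal_mult)
    finally show "ennreal \<bar>conv f \<rho> x\<bar> \<le> \<dots>" .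
  qed
  also have "\<dots> = (\<integral>\<^sup>+y. \<integral>\<^sup>+x. ennreal \<bar>f y\<bar> * ennreal (\<rho> (x - y)) \<partial>lebesgue \<partial>lebesgue)"
    by (rule P.Fubini') measurable
  also have "\<dots> = (\<integral>\<^sup>+y. ennreal \<bar>f y\<bar> * 1 \<partial>lebesgue)"
  proof (rule nn_integral_cong)
    fix y
    have "(\<lambda>x. ennreal (\<rho> (x - y))) \<in> borel_measurable lebesgue"
      by measurable
    then show "(\<integral>\<^sup>+x. ennreal \<bar>f y\<bar> * ennreal (\<rho> (x - y)) \<partial>lebesgue) = ennreal \<bar>f y\<bar> * 1"
      using mollifier_nn_integral(1)[OF \<rho>, of y] by (simp add: nn_integral_cmult)
  qed
  finally show ?thesis by simp
qed

lemma conv_L1: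
  fixes f :: "'a::euclidean_space \<Rightarrow> real"
  assumes f: "integrable lebesgue f" and \<rho>: "mollifier r \<rho>"
  shows "integrable lebesgue (conv f \<rho>)"
    and "(\<integral>x. \<bar>conv f \<rho> x\<bar> \<partial>lebesgue) \<le> (\<integral>x. \<bar>f x\<bar> \<partial>lebesgue)"
proof -
  have fin: "(\<integral>\<^sup>+x. ennreal \<bar>f x\<bar> \<partial>lebesgue) = ennreal (\<integral>x. \<bar>f x\<bar> \<partial>lebesgue)"
    using f by (intro nn_integral_eq_integral) auto
  show int: "integrable lebesgue (conv f \<rho>)"
    unfolding integrable_iff_bounded
    using conv_L1_contraction_nn[OF assms] conv_measurable[OF f] \<rho> fin
    by (auto simp: mollifier_def intro: le_less_trans)
  then have "ennreal (\<integral>x. \<bar>conv f \<rho> x\<bar> \<partial>lebesgue) \<le> ennreal (\<integral>x. \<bar>f x\<bar> \<partial>lebesgue)"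
    using conv_L1_contraction_nn[OF assms] fin by (subst nn_integral_eq_integral[symmetric]) auto
  then show "(\<integral>x. \<bar>conv f \<rho> x\<bar> \<partial>lebesgue) \<le> (\<integral>x. \<bar>f x\<bar> \<partial>lebesgue)"
    by (simp add: ennreal_le_iff)
qed

section \<open>Pointwise bounds and L1 convergence of mollifications\<close>

lemma conv_bounded:
  assumes f: "integrable lebesgue f" and \<rho>: "mollifier r \<rho>" and B: "AE y in lebesgue. \<bar>f y\<bar> \<le> B"
  shows "\<bar>conv f \<rho> x\<bar> \<le> B"
proof -
  note hb = mollifier_has_bochner_integral[OF \<rho>, of x]
  have nn: "0 \<le> \<rho> z" and tf: "test_fun \<rho>" for z using \<rho> by (auto simp: mollifier_def)
  \<comment> \<open>The kernel is a probability density, so an almost everywhere bound on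
    \<open>f\<close> bounds the average at every \<open>x\<close>.\<close>
  have "\<bar>conv f \<rho> x\<bar> \<le> (\<integral>y. B * \<rho> (x - y) \<partial>lebesgue)"
    unfolding conv_def real_norm_def[symmetric]
    by (rule order_trans[OF integral_norm_bound integral_mono_AE])
       (use B hb integrable_norm[OF conv_integrable[OF f tf], of x] in
         \<open>auto simp: abs_mult nn mult_right_mono has_bochner_integral_iff elim!: eventually_mono\<close>)
  also have "\<dots> = B" using has_bochner_integral_integral_eq[OF hb] by simp
  finally show ?thesis .
qed

text \<open>The convolution averages the values of \<open>f\<close> over the ball of radius
  \<open>r\<close> around \<open>x\<close>; outside it the kernel is zero.\<close>

lemma conv_near:
  assumes f: "integrable lebesgue f" and \<rho>: "mollifier r \<rho>"
    and near: "\<And>y. norm (x - y) \<le> r \<Longrightarrow> \<bar>f y - f x\<bar> \<le> e"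
  shows "\<bar>conv f \<rho> x - f x\<bar> \<le> e"
proof -
  note hb = mollifier_has_bochner_integral[OF \<rho>, of x]
  have i: "integrable lebesgue (\<lambda>y. \<rho> (x - y))" and I: "(\<integral>y. \<rho> (x - y) \<partial>lebesgue) = 1"
    using hb by (auto simp: has_bochner_integral_iff)
  have nn: "0 \<le> \<rho> z" and tf: "test_fun \<rho>" for z using \<rho> by (auto simp: mollifier_def)
  have "conv f \<rho> x - f x = (\<integral>y. f y * \<rho> (x - y) - f x * \<rho> (x - y) \<partial>lebesgue)"
    unfolding conv_def using conv_integrable[OF f tf] i I by simp
  also have "\<bar>\<dots>\<bar> \<le> (\<integral>y. e * \<rho> (x - y) \<partial>lebesgue)"
    unfolding real_norm_def[symmetric]
  proof (rule Bochner_Integration.integral_norm_bound_integral)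
    show "norm (f y * \<rho> (x - y) - f x * \<rho> (x - y)) \<le> e * \<rho> (x - y)" for y
    proof (cases "norm (x - y) \<le> r")
      case True
      then show ?thesis
        using mult_right_mono[OF near nn] by (simp add: left_diff_distrib[symmetric] abs_mult nn)
    next
      case False
      then have "\<rho> (x - y) = 0" using \<rho> by (auto simp: mollifier_def)
      then show ?thesis by simp
    qed
  qed (use conv_integrable[OF f tf] i in auto)
  also have "\<dots> = e" using I by simp
  finally show ?thesis .
qed

text \<open>A measurable function is an almost everywhere limit of continuous ones. Truncating these
  in height and in space keeps them continuous and dominated by a multiple of the indicator of a
  ball, so dominated convergence applies.\<close>

lemma continuous_approx_L1:
  fixes f :: "'a::euclidean_space \<Rightarrow> real"
  assumes f[measurable]: "f \<in> borel_measurable lebesgue" and B: "AE x in lebesgue. \<bar>f x\<bar> \<le> B"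
    and R: "\<And>x. R < norm x \<Longrightarrow> f x = 0" and "e > 0"
  obtains g where "continuous_on UNIV g" "\<And>x. R + 1 < norm x \<Longrightarrow> g x = 0"
    "integrable lebesgue g" "(\<integral>x. \<bar>f x - g x\<bar> \<partial>lebesgue) < e"
proof -
  have "f measurable_on UNIV"
    by (intro lebesgue_measurable_imp_measurable_on_real) auto
  then obtain N G where N: "negligible N" and contG: "\<And>n. continuous_on UNIV (G n)"
    and lim: "\<And>x. x \<notin> N \<Longrightarrow> (\<lambda>n. G n x) \<longlonglongrightarrow> f x"
    unfolding measurable_on_def by auto
  define C where "C = max 0 B"
  \<comment> \<open>The first factor clips \<open>G n\<close> to the interval from
    \<open>- C\<close> to \<open>C\<close>. The second is a continuous cutoff, 1 for norm at most
    \<open>R\<close> and 0 for norm at least \<open>R + 1\<close>, and so does not change the limit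
    \<open>f\<close>.\<close>
  define g where "g n x = max (- C) (min C (G n x)) * max 0 (min 1 (R + 1 - norm x))" for n x
  have C0: "C \<ge> 0" by (simp add: C_def)
  have cont: "continuous_on UNIV (g n)" for n
    unfolding g_def by (intro continuous_intros contG)
  have out: "g n x = 0" if "R + 1 < norm x" for n x
    using that by (simp add: g_def)
  have bnd: "\<bar>g n x\<bar> \<le> C * indicator (cball 0 (R + 1)) x" for n x
  proof (cases "x \<in> cball 0 (R + 1)")
    case True
    have "\<bar>g n x\<bar> \<le> C * 1"
      unfolding g_def abs_mult using C0 by (intro mult_mono) auto
    then show ?thesis using True by simp
  qed (use out in auto)
  have meas[measurable]: "g n \<in> borel_measurable lebesgue" for n
    by (rule continuous_imp_measurable_lebesgue[OF cont])
  have ic: "integrable lebesgue (\<lambda>x. C * indicator (cball (0::'a) (R + 1)) x)"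
    using emeasure_bounded_finite[of "cball (0::'a) (R + 1)"]
    by (intro integrable_mult_right integrable_real_indicator) auto
  have int: "integrable lebesgue (g n)" for n
    by (rule Bochner_Integration.integrable_bound[OF ic]) (use bnd C0 in auto)
  have "(\<lambda>n. \<integral>x. \<bar>f x - g n x\<bar> \<partial>lebesgue) \<longlonglongrightarrow> (\<integral>x. 0 \<partial>(lebesgue :: 'a measure))"
  proof (rule integral_dominated_convergence)
    show "integrable lebesgue (\<lambda>x. 2 * (C * indicator (cball (0::'a) (R + 1)) x))"
      using ic by simp
    have "AE x in lebesgue. x \<notin> N"
      using N by (simp add: AE_not_in negligible_iff_null_sets)
    then show "AE x in lebesgue. (\<lambda>n. \<bar>f x - g n x\<bar>) \<longlonglongrightarrow> 0"
      using B
    proof eventually_elim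
      case (elim x)
      have "(\<lambda>n. \<bar>f x - g n x\<bar>) \<longlonglongrightarrow> \<bar>f x - max (- C) (min C (f x)) * max 0 (min 1 (R + 1 - norm x))\<bar>"
        unfolding g_def by (intro tendsto_intros lim elim)
      also have "f x - max (- C) (min C (f x)) * max 0 (min 1 (R + 1 - norm x)) = 0"
      proof (cases "R < norm x")
        case False
        moreover have "max (- C) (min C (f x)) = f x" using elim by (auto simp: C_def)
        ultimately show ?thesis by simp
      qed (use R C0 in simp)
      finally show ?case by simp
    qed
    show "AE x in lebesgue. norm \<bar>f x - g n x\<bar> \<le> 2 * (C * indicator (cball 0 (R + 1)) x)" for n
      using B
    proof eventually_elim
      case (elim x)
      have "\<bar>f x\<bar> \<le> C * indicator (cball 0 (R + 1)) x"
        using elim R[of x] by (cases "x \<in> cball 0 (R + 1)") (auto simp: C_def)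
      then show ?case using bnd[of n x] by auto
    qed
  qed auto
  then have "(\<lambda>n. \<integral>x. \<bar>f x - g n x\<bar> \<partial>lebesgue) \<longlonglongrightarrow> 0" by simp
  then have "\<forall>\<^sub>F n in sequentially. (\<integral>x. \<bar>f x - g n x\<bar> \<partial>lebesgue) < e"
    using \<open>e > 0\<close> by (rule order_tendstoD(2))
  then obtain n where "(\<integral>x. \<bar>f x - g n x\<bar> \<partial>lebesgue) < e"
    by (auto simp: eventually_sequentially)
  then show ?thesis using that[of "g n"] cont out int by blast
qed

lemma integrable_bounded_support:
  fixes f :: "'a::euclidean_space \<Rightarrow> real"
  assumes f[measurable]: "f \<in> borel_measurable lebesgue" and B: "AE x in lebesgue. \<bar>f x\<bar> \<le> B"
    and R: "\<And>x. R < norm x \<Longrightarrow> f x = 0"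
  shows "integrable lebesgue f"
proof (rule Bochner_Integration.integrable_bound)
  show "integrable lebesgue (\<lambda>x. B * indicator (cball (0::'a) R) x)"
    using emeasure_bounded_finite[of "cball (0::'a) R"]
    by (intro integrable_mult_right integrable_real_indicator) auto
  show "AE x in lebesgue. norm (f x) \<le> norm (B * indicator (cball 0 R) x)"
    using B by eventually_elim (use R in \<open>auto simp: indicator_def\<close>)
qed auto

text \<open>Density argument with a continuous \<open>g\<close>: the contraction controls the
  mollification of \<open>f - g\<close>, uniform continuity controls
  \<open>conv g (\<rho> n) - g\<close>, and the choice of \<open>g\<close> controls
  \<open>g - f\<close>. Each part receives a third of \<open>e\<close>.\<close>

lemma conv_tendsto_L1:
  fixes f :: "'a::euclidean_space \<Rightarrow> real"
  assumes f[measurable]: "f \<in> borel_measurable lebesgue" and B: "AE x in lebesgue. \<bar>f x\<bar> \<le> B"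
    and R: "\<And>x. R < norm x \<Longrightarrow> f x = 0"
    and \<rho>: "\<And>n. mollifier (1 / Suc n) (\<rho> n)"
  shows "(\<lambda>n. \<integral>x. \<bar>conv f (\<rho> n) x - f x\<bar> \<partial>lebesgue) \<longlonglongrightarrow> 0"
proof (rule LIMSEQ_I)
  fix e :: real assume "e > 0"
  have fi: "integrable lebesgue f" by (rule integrable_bounded_support[OF f B R])
  obtain g where g: "continuous_on UNIV g" "\<And>x. R + 1 < norm x \<Longrightarrow> g x = 0"
    "integrable lebesgue g" "(\<integral>x. \<bar>f x - g x\<bar> \<partial>lebesgue) < e / 3"
    by (rule continuous_approx_L1[where e = "e / 3", OF f B R]) (use \<open>e > 0\<close> in auto)
  \<comment> \<open>The function \<open>g\<close> lives in the ball of radius \<open>R + 1\<close>,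
    and a kernel of radius at most 1 enlarges this to \<open>R + 2\<close>; the uniform bound
    \<open>c\<close> is integrated over that ball.\<close>
  define V where "V = measure lebesgue (cball (0::'a) (R + 2))"
  define c where "c = e / (3 * (V + 1))"
  have "V \<ge> 0" by (simp add: V_def)
  have "c > 0" and cV: "c * V \<le> e / 3"
    using \<open>e > 0\<close> \<open>V \<ge> 0\<close> by (auto simp: c_def field_simps)
  have "uniformly_continuous_on UNIV g"
    using g(1,2) by (intro uniformly_continuous_compact_support[where K = "cball 0 (R + 1)"]) auto
  then obtain d where "d > 0" and d: "\<And>x y. norm (y - x) < d \<Longrightarrow> \<bar>g y - g x\<bar> < c"
    using \<open>c > 0\<close> unfolding uniformly_continuous_on_def dist_norm by (metis UNIV_I real_norm_def)
  obtain n0 where n0: "1 / Suc n0 < d"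
    using \<open>d > 0\<close> reals_Archimedean[of d] by (auto simp: inverse_eq_divide)
  have "\<bar>\<integral>x. \<bar>conv f (\<rho> n) x - f x\<bar> \<partial>lebesgue\<bar> < e" if "n \<ge> n0" for n
  proof -
    have tf: "test_fun (\<rho> n)" using \<rho> by (auto simp: mollifier_def)
    have small: "1 / Suc n < d"
      using n0 that by (smt (verit) frac_le of_nat_mono of_nat_0_less_iff Suc_le_mono zero_less_Suc)
    have fgi: "integrable lebesgue (\<lambda>x. f x - g x)" using fi g(3) by simp
    have cadd: "conv f (\<rho> n) x = conv (\<lambda>x. f x - g x) (\<rho> n) x + conv g (\<rho> n) x" for x
      unfolding conv_def
      using conv_integrable[OF fi tf, of x] conv_integrable[OF g(3) tf, of x]
      by (simp add: left_diff_distrib)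
    have near: "\<bar>conv g (\<rho> n) x - g x\<bar> \<le> c * indicator (cball 0 (R + 2)) x" for x
    proof (cases "x \<in> cball 0 (R + 2)")
      case True
      have "\<bar>conv g (\<rho> n) x - g x\<bar> \<le> c"
        using d small by (intro conv_near[OF g(3) \<rho>]) (simp add: norm_minus_commute less_imp_le)
      then show ?thesis using True by simp
    next
      case False
      have "conv g (\<rho> n) x = 0"
      proof (rule conv_outside[OF g(2)])
        show "1 / Suc n < norm z \<Longrightarrow> \<rho> n z = 0" for z
          using \<rho>[of n] by (auto simp: mollifier_def)
        have "1 / real (Suc n) \<le> 1" "R + 2 < norm x" using False by simp_all
        then show "R + 1 + 1 / Suc n < norm x" by linarith
      qed auto
      then show ?thesis using False g(2)[of x] by simp
    qed
    have ic: "integrable lebesgue (\<lambda>x. c * indicator (cball (0::'a) (R + 2)) x)"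
      using emeasure_bounded_finite[of "cball (0::'a) (R + 2)"]
      by (intro integrable_mult_right integrable_real_indicator) auto
    note ii = conv_L1(1)[OF fi \<rho>[of n]] conv_L1(1)[OF fgi \<rho>[of n]]
    have "(\<integral>x. \<bar>conv f (\<rho> n) x - f x\<bar> \<partial>lebesgue)
      \<le> (\<integral>x. (\<bar>conv (\<lambda>x. f x - g x) (\<rho> n) x\<bar> + c * indicator (cball 0 (R + 2)) x) + \<bar>f x - g x\<bar> \<partial>lebesgue)"
    proof (rule integral_mono)
      show "\<bar>conv f (\<rho> n) x - f x\<bar> \<le> (\<bar>conv (\<lambda>x. f x - g x) (\<rho> n) x\<bar> + c * indicator (cball 0 (R + 2)) x) + \<bar>f x - g x\<bar>" for x
        using near[of x] unfolding cadd by linarith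
    qed (use ii fi fgi ic in auto)
    also have "\<dots> = (\<integral>x. \<bar>conv (\<lambda>x. f x - g x) (\<rho> n) x\<bar> \<partial>lebesgue) + c * V + (\<integral>x. \<bar>f x - g x\<bar> \<partial>lebesgue)"
      using ii fgi ic by (simp add: V_def)
    also have "\<dots> < e" using conv_L1(2)[OF fgi \<rho>[of n]] cV g(4) by linarith
    finally show ?thesis by simp
  qed
  then show "\<exists>no. \<forall>n\<ge>no. norm ((\<integral>x. \<bar>conv f (\<rho> n) x - f x\<bar> \<partial>lebesgue) - 0) < e"
    by auto
qed

section \<open>Testing with a power of a Lipschitz function\<close>

text \<open>The cutoffs to growing balls are integrable, and at each point they eventually agree
  with \<open>f\<close>.\<close>

lemma loc_integrable_measurable:
  fixes f :: "'a::euclidean_space \<Rightarrow> 'b::{banach,second_countable_topology}"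
  assumes "loc_integrable f"
  shows "f \<in> borel_measurable lebesgue"
proof (rule borel_measurable_LIMSEQ_metric)
  show "(\<lambda>x. indicat_real (cball 0 (real n)) x *\<^sub>R f x) \<in> borel_measurable lebesgue" for n
    using assms unfolding loc_integrable_def set_integrable_def by (intro borel_measurable_integrable) auto
  show "(\<lambda>n. indicat_real (cball 0 (real n)) x *\<^sub>R f x) \<longlonglongrightarrow> f x" for x :: 'a
  proof (rule tendsto_eventually)
    obtain N where "norm x \<le> real N" using real_arch_simple by blast
    then have "indicat_real (cball 0 (real n)) x *\<^sub>R f x = f x" if "n \<ge> N" for n
      using that by (simp add: indicator_def)
    then show "\<forall>\<^sub>F n in sequentially. indicat_real (cball 0 (real n)) x *\<^sub>R f x = f x"
      by (auto simp: eventually_sequentially)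
  qed
qed

section \<open>Regularised powers of numbers and of test functions\<close>

lemma square_powr_half:
  fixes a p :: real
  shows "(a\<^sup>2) powr (p / 2) = \<bar>a\<bar> powr p"
proof (cases "a = 0")
  case False
  then have "a\<^sup>2 = \<bar>a\<bar> powr 2" by (simp add: powr_numeral)
  then have "(a\<^sup>2) powr (p / 2) = (\<bar>a\<bar> powr 2) powr (p / 2)" by (rule arg_cong)
  also have "\<dots> = \<bar>a\<bar> powr p" unfolding powr_powr by simp
  finally show ?thesis .
qed simp

text \<open>For \<open>q < 2\<close> the factor with exponent \<open>q / 2 - 1\<close> blows up as
  \<open>a\<close> and \<open>d\<close> tend to 0. Bounding the absolute value of \<open>a\<close>
  by the square root of the base leaves the exponent \<open>(q - 1) / 2\<close>, which is positive
  once \<open>q > 1\<close>.\<close>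

lemma regularized_powr_bound:
  fixes a d q :: real
  shows "\<bar>(a\<^sup>2 + d\<^sup>2) powr (q / 2 - 1) * a\<bar> \<le> (a\<^sup>2 + d\<^sup>2) powr ((q - 1) / 2)"
proof -
  have "\<bar>a\<bar> = (a\<^sup>2) powr (1 / 2)" by (simp add: square_powr_half)
  also have "\<dots> \<le> (a\<^sup>2 + d\<^sup>2) powr (1 / 2)" by (intro powr_mono2) auto
  finally have "\<bar>(a\<^sup>2 + d\<^sup>2) powr (q / 2 - 1) * a\<bar>
      \<le> (a\<^sup>2 + d\<^sup>2) powr (q / 2 - 1) * (a\<^sup>2 + d\<^sup>2) powr (1 / 2)"
    by (simp add: abs_mult mult_left_mono)
  also have "\<dots> = (a\<^sup>2 + d\<^sup>2) powr ((q - 1) / 2)"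
    by (simp add: powr_add[symmetric] field_simps)
  finally show ?thesis .
qed

lemma regularized_powr_tendsto:
  fixes a d :: "nat \<Rightarrow> real"
  assumes a: "a \<longlonglongrightarrow> b" and d: "d \<longlonglongrightarrow> 0" and "q > 0"
  shows "(\<lambda>n. ((a n)\<^sup>2 + (d n)\<^sup>2) powr (q / 2)) \<longlonglongrightarrow> \<bar>b\<bar> powr q"
proof -
  have "(\<lambda>n. ((a n)\<^sup>2 + (d n)\<^sup>2) powr (q / 2)) \<longlonglongrightarrow> (b\<^sup>2 + 0\<^sup>2) powr (q / 2)"
    using assms by (intro tendsto_powr' tendsto_intros) auto
  then show ?thesis by (simp add: square_powr_half)
qed

lemma regularized_powr_deriv_tendsto:
  fixes a d :: "nat \<Rightarrow> real"
  assumes a: "a \<longlonglongrightarrow> b" and d: "d \<longlonglongrightarrow> 0" and "q > 1"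
  shows "(\<lambda>n. ((a n)\<^sup>2 + (d n)\<^sup>2) powr (q / 2 - 1) * a n) \<longlonglongrightarrow> \<bar>b\<bar> powr (q - 2) * b"
proof (cases "b = 0")
  \<comment> \<open>The base tends to 0 and its exponent may be negative, so the limit comes from
    squeezing under the preceding bound and not from continuity of powers.\<close>
  case True
  have "(\<lambda>n. ((a n)\<^sup>2 + (d n)\<^sup>2) powr ((q - 1) / 2)) \<longlonglongrightarrow> \<bar>b\<bar> powr (q - 1)"
    using regularized_powr_tendsto[OF a d, of "q - 1"] \<open>q > 1\<close> by simp
  then have "(\<lambda>n. ((a n)\<^sup>2 + (d n)\<^sup>2) powr ((q - 1) / 2)) \<longlonglongrightarrow> 0" using True by simp
  then have "(\<lambda>n. ((a n)\<^sup>2 + (d n)\<^sup>2) powr (q / 2 - 1) * a n) \<longlonglongrightarrow> 0"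
    by (rule Lim_null_comparison[rotated]) (use regularized_powr_bound in auto)
  then show ?thesis using True by simp
next
  case False
  have "(\<lambda>n. ((a n)\<^sup>2 + (d n)\<^sup>2) powr (q / 2 - 1) * a n) \<longlonglongrightarrow> (b\<^sup>2 + 0\<^sup>2) powr (q / 2 - 1) * b"
    using False by (intro tendsto_intros a d) auto
  moreover have "(b\<^sup>2) powr (q / 2 - 1) = \<bar>b\<bar> powr (q - 2)"
    using square_powr_half[of b "q - 2"] by (simp add: diff_divide_distrib)
  ultimately show ?thesis by simp
qed

lemma partial_deriv_regularized_powr:
  fixes f :: "'a::euclidean_space \<Rightarrow> real"
  assumes "smooth_fun f" "d \<noteq> 0"
  shows "partial_deriv (\<lambda>x. ((f x)\<^sup>2 + d\<^sup>2) powr (q / 2) - c) i x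
    = q * (((f x)\<^sup>2 + d\<^sup>2) powr (q / 2 - 1) * f x) * partial_deriv f i x"
proof -
  have pos: "(f x)\<^sup>2 + d\<^sup>2 > 0" using assms by (simp add: add_nonneg_pos)
  have "((\<lambda>t. (t\<^sup>2 + d\<^sup>2) powr (q / 2) - c) has_real_derivative
      q * (((f x)\<^sup>2 + d\<^sup>2) powr (q / 2 - 1) * f x)) (at (f x))"
    using pos by (auto intro!: derivative_eq_intros simp: powr_diff)
      (simp add: divide_simps)
  from partial_deriv_eq[OF DERIV_compose_FDERIV[OF this smooth_fun_has_derivative[OF assms(1)]]]
  show ?thesis by (simp add: mult.commute)
qed

text \<open>A nonzero \<open>d\<close> keeps the base positive and hence the power smooth;
  subtracting its value at \<open>f x = 0\<close> restores the compact support.\<close>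

lemma test_fun_regularized_powr:
  fixes f :: "'a::euclidean_space \<Rightarrow> real"
  assumes "test_fun f" "d \<noteq> 0"
  shows "test_fun (\<lambda>x. ((f x)\<^sup>2 + d\<^sup>2) powr (q / 2) - (d\<^sup>2) powr (q / 2))"
proof -
  obtain K where K: "compact K" "\<And>x. x \<notin> K \<Longrightarrow> f x = 0" and sm: "smooth_fun f"
    using assms by (auto simp: test_fun_def)
  have "Ck n (\<lambda>x. (f x * f x + d\<^sup>2) powr (q / 2) + (- ((d\<^sup>2) powr (q / 2))))" for n
    using sm assms(2) unfolding smooth_fun_iff_Ck
    by (intro Ck_add Ck_const Ck_powr Ck_mult) (auto intro: add_nonneg_pos)
  then have "smooth_fun (\<lambda>x. ((f x)\<^sup>2 + d\<^sup>2) powr (q / 2) - (d\<^sup>2) powr (q / 2))"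
    by (simp add: smooth_fun_iff_Ck power2_eq_square)
  then show ?thesis
    unfolding test_fun_def using K by (intro conjI exI[of _ K]) auto
qed

text \<open>Both sides of the identity for the regularised test functions pass to the limit,
  dominated by multiples of the norms of \<open>h\<close> and \<open>F\<close> on a fixed ball.
  Integrability is part of the conclusion because a Bochner integral of a nonintegrable function
  defaults to 0, and the norm bound for integrals relies on it.\<close>

lemma weak_divergence_powr:
  fixes F :: "'a::euclidean_space \<Rightarrow> 'a" and h \<phi> :: "'a \<Rightarrow> real" and \<Phi> :: "'a \<Rightarrow> 'a"
  assumes q: "q > 1" and F: "loc_integrable F" and h: "loc_integrable h"
    and div: "\<forall>\<psi>. test_fun \<psi> \<longrightarrow>
      (\<integral>x. (\<Sum>i\<in>Basis. (F x \<bullet> i) * partial_deriv \<psi> i x) \<partial>lebesgue) = - (\<integral>x. h x * \<psi> x \<partial>lebesgue)"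
    and \<phi>: "W1inf \<phi> \<Phi>" and K: "compact K" "\<forall>x. x \<notin> K \<longrightarrow> \<phi> x = 0"
  shows "integrable lebesgue (\<lambda>x. h x * \<bar>\<phi> x\<bar> powr q)"
    and "integrable lebesgue (\<lambda>x. q * (\<bar>\<phi> x\<bar> powr (q - 2) * \<phi> x) * (F x \<bullet> \<Phi> x))"
    and "(\<integral>x. q * (\<bar>\<phi> x\<bar> powr (q - 2) * \<phi> x) * (F x \<bullet> \<Phi> x) \<partial>lebesgue)
      = - (\<integral>x. h x * \<bar>\<phi> x\<bar> powr q \<partial>lebesgue)"
proof -
  obtain R where R: "\<And>x. x \<in> K \<Longrightarrow> norm x \<le> R"
    using compact_imp_bounded[OF K(1)] by (auto simp: bounded_iff)
  have \<phi>0: "\<phi> x = 0" if "R < norm x" for x using R K(2) that by fastforce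
  have wg: "weak_gradient \<phi> \<Phi>" and [measurable]: "\<phi> \<in> borel_measurable lebesgue" "\<Phi> \<in> borel_measurable lebesgue"
    using \<phi> by (auto simp: W1inf_def ess_bounded_def)
  have Fm[measurable]: "F \<in> borel_measurable lebesgue" and hm[measurable]: "h \<in> borel_measurable lebesgue"
    using F h by (auto intro: loc_integrable_measurable)
  obtain B where B: "AE x in lebesgue. \<bar>\<phi> x\<bar> \<le> B" using \<phi> by (auto simp: W1inf_def ess_bounded_def)
  obtain C where C: "AE x in lebesgue. norm (\<Phi> x) \<le> C" using \<phi> by (auto simp: W1inf_def ess_bounded_def)
  \<comment> \<open>Cutting off \<open>\<Phi>\<close> avoids having to show that it vanishes almost everywhere off \<open>K\<close>.\<close>
  define D where "D i x = indicat_real (cball 0 (R + 2)) x * (\<Phi> x \<bullet> i)" for i x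
  have Dm[measurable]: "D i \<in> borel_measurable lebesgue" for i
    unfolding D_def by (intro borel_measurable_times borel_measurable_indicator borel_measurable_inner) auto
  have D0: "D i x = 0" if "R + 2 < norm x" for i x using that by (simp add: D_def)
  have DC: "AE x in lebesgue. \<bar>D i x\<bar> \<le> C" if "i \<in> Basis" for i
    using C
  proof eventually_elim
    case (elim x)
    have "\<bar>\<Phi> x \<bullet> i\<bar> \<le> C" "0 \<le> C" using Basis_le_norm[OF that, of "\<Phi> x"] elim norm_ge_zero[of "\<Phi> x"] by linarith+
    then show ?case by (simp add: D_def indicator_def)
  qed
  have \<phi>i: "integrable lebesgue \<phi>" by (rule integrable_bounded_support[OF _ B \<phi>0]) simp
  have Di: "integrable lebesgue (D i)" if "i \<in> Basis" for i
    by (rule integrable_bounded_support[OF Dm DC[OF that] D0])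
  have "\<exists>\<rho> :: 'a \<Rightarrow> real. mollifier (1 / Suc n) \<rho>" for n
    using mollifier_exists[of "1 / Suc n"] by (metis of_nat_0_less_iff zero_less_Suc zero_less_divide_1_iff)
  then obtain \<rho> :: "nat \<Rightarrow> 'a \<Rightarrow> real" where \<rho>: "\<And>n. mollifier (1 / Suc n) (\<rho> n)" by metis
  have tf: "test_fun (\<rho> n)" and \<rho>0: "1 / Suc n < norm z \<Longrightarrow> \<rho> n z = 0" for n z
    using \<rho>[of n] by (auto simp: mollifier_def)
  have n1: "1 / real (Suc n) \<le> 1" for n by simp
  define f where "f n = conv \<phi> (\<rho> n)" for n
  have f0: "f n x = 0" if "R + 1 < norm x" for n x
  proof -
    have "R + 1 / Suc n < norm x" using that n1[of n] by linarith
    then show ?thesis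
      unfolding f_def by (intro conv_outside[of R \<phi> "1 / Suc n" "\<rho> n" x] \<phi>0 \<rho>0)
  qed
  have fs: "smooth_fun (f n)" for n unfolding f_def by (rule smooth_fun_conv[OF \<phi>i tf])
  have ft: "test_fun (f n)" for n
    unfolding test_fun_def using fs f0 by (intro conjI exI[of _ "cball 0 (R + 1)"]) auto
  have fB: "\<bar>f n x\<bar> \<le> B" for n x unfolding f_def by (rule conv_bounded[OF \<phi>i \<rho> B])
  have fD: "partial_deriv (f n) i x = indicat_real (cball 0 (R + 1)) x * conv (D i) (\<rho> n) x"
    if i: "i \<in> Basis" for n i x
  proof (cases "x \<in> cball 0 (R + 1)")
    case True
    \<comment> \<open>For \<open>x\<close> of norm at most \<open>R + 1\<close> the kernel sees only
      \<open>y\<close> of norm at most \<open>R + 2\<close>, where \<open>D i\<close> is the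
      component of \<open>\<Phi>\<close>.\<close>
    have "(\<Phi> y \<bullet> i) * \<rho> n (x - y) = D i y * \<rho> n (x - y)" for y
    proof (cases "y \<in> cball 0 (R + 2)")
      case False
      then have "R + 2 < norm y" "norm x \<le> R + 1" using True by simp_all
      then have "1 / Suc n < norm (x - y)"
        using n1[of n] norm_triangle_sub[of y x] norm_minus_commute[of x y] by linarith
      then show ?thesis using \<rho>0 by simp
    qed (simp add: D_def)
    then have "conv (\<lambda>y. \<Phi> y \<bullet> i) (\<rho> n) x = conv (D i) (\<rho> n) x" by (simp only: conv_def)
    then show ?thesis
      using True partial_deriv_conv_weak_gradient[OF \<phi>i wg tf i] by (simp add: f_def)
  next
    case False
    then show ?thesis
      using partial_deriv_outside[of "cball 0 (R + 1)" "f n" x i] f0 by simp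
  qed
  \<comment> \<open>Collecting all errors in one function lets a single subsequence serve
    \<open>f n\<close> and every component of its gradient.\<close>
  define E where "E n x = \<bar>f n x - \<phi> x\<bar> + (\<Sum>i\<in>Basis. \<bar>conv (D i) (\<rho> n) x - D i x\<bar>)" for n x
  have i1: "integrable lebesgue (\<lambda>x. \<bar>f n x - \<phi> x\<bar>)" for n
    unfolding f_def using conv_L1(1)[OF \<phi>i \<rho>] \<phi>i by simp
  have i2: "integrable lebesgue (\<lambda>x. \<bar>conv (D i) (\<rho> n) x - D i x\<bar>)" if "i \<in> Basis" for n i
    using conv_L1(1)[OF Di \<rho>] Di that by simp
  have Ei: "integrable lebesgue (E n)" for n
    unfolding E_def using i1 i2 by simp
  have E0: "0 \<le> E n x" for n x by (simp add: E_def sum_nonneg)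
  have "(\<lambda>n. \<integral>x. norm (E n x) \<partial>lebesgue) \<longlonglongrightarrow> 0"
  proof -
    have "(\<lambda>n. (\<integral>x. \<bar>f n x - \<phi> x\<bar> \<partial>lebesgue) + (\<Sum>i\<in>Basis. \<integral>x. \<bar>conv (D i) (\<rho> n) x - D i x\<bar> \<partial>lebesgue))
        \<longlonglongrightarrow> 0 + (\<Sum>i\<in>(Basis :: 'a set). 0)"
      unfolding f_def
      by (intro tendsto_add tendsto_sum conv_tendsto_L1[OF _ B \<phi>0 \<rho>] conv_tendsto_L1[OF Dm DC D0 \<rho>]) auto
    moreover have "(\<integral>x. norm (E n x) \<partial>lebesgue) =
        (\<integral>x. \<bar>f n x - \<phi> x\<bar> \<partial>lebesgue) + (\<Sum>i\<in>Basis. \<integral>x. \<bar>conv (D i) (\<rho> n) x - D i x\<bar> \<partial>lebesgue)" for n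
      using E0[of n] i1 i2 by (simp add: E_def)
    ultimately show ?thesis by simp
  qed
  then obtain r where r: "AE x in lebesgue. (\<lambda>n. E (r n) x) \<longlonglongrightarrow> 0"
    using tendsto_L1_AE_subseq[of lebesgue E, OF Ei] by blast
  have lim: "(\<lambda>n. f (r n) x) \<longlonglongrightarrow> \<phi> x"
       "i \<in> Basis \<Longrightarrow> (\<lambda>n. conv (D i) (\<rho> (r n)) x) \<longlonglongrightarrow> D i x"
    if "(\<lambda>n. E (r n) x) \<longlonglongrightarrow> 0" for x i
  proof -
    have "norm (f (r n) x - \<phi> x) \<le> E (r n) x" for n by (simp add: E_def sum_nonneg)
    then have "(\<lambda>n. f (r n) x - \<phi> x) \<longlonglongrightarrow> 0" by (intro Lim_null_comparison[OF _ that]) auto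
    then show "(\<lambda>n. f (r n) x) \<longlonglongrightarrow> \<phi> x" by (simp add: LIM_zero_iff)
    assume i: "i \<in> Basis"
    have "norm (conv (D i) (\<rho> (r n)) x - D i x) \<le> E (r n) x" for n
      using member_le_sum[OF i, of "\<lambda>i. \<bar>conv (D i) (\<rho> (r n)) x - D i x\<bar>"] by (simp add: E_def)
    then have "(\<lambda>n. conv (D i) (\<rho> (r n)) x - D i x) \<longlonglongrightarrow> 0" by (intro Lim_null_comparison[OF _ that]) auto
    then show "(\<lambda>n. conv (D i) (\<rho> (r n)) x) \<longlonglongrightarrow> D i x" by (simp add: LIM_zero_iff)
  qed
  \<comment> \<open>A null sequence of nonzero numbers bounded by 1: nonzero for smoothness, bounded
    for the uniform bound on \<open>u\<close>.\<close>
  define d where "d n = 1 / real (Suc n)" for n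
  have d: "d \<longlonglongrightarrow> 0" "d n \<noteq> 0" "(d n)\<^sup>2 \<le> 1" for n
    unfolding d_def using LIMSEQ_inverse_real_of_nat by (auto simp: inverse_eq_divide power_le_one)
  define u where "u n x = (f (r n) x)\<^sup>2 + (d n)\<^sup>2" for n x
  define \<psi> where "\<psi> n x = u n x powr (q / 2) - ((d n)\<^sup>2) powr (q / 2)" for n x
  define w where "w n x = u n x powr (q / 2 - 1) * f (r n) x" for n x
  have \<psi>t: "test_fun (\<psi> n)" for n
    unfolding \<psi>_def u_def by (rule test_fun_regularized_powr[OF ft d(2)])
  have \<psi>D: "partial_deriv (\<psi> n) i x = q * w n x * partial_deriv (f (r n)) i x" for n i x
    unfolding \<psi>_def u_def w_def by (rule partial_deriv_regularized_powr[OF fs d(2)])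
  have \<psi>0: "\<psi> n x = 0" if "R + 1 < norm x" for n x
    using f0[OF that] by (simp add: \<psi>_def u_def)
  have uB: "u n x \<le> B\<^sup>2 + 1" "0 \<le> u n x" for n x
    using power_mono[OF fB[of "r n" x] abs_ge_zero, of 2] d(3)[of n] by (auto simp: u_def)
  define M where "M = (B\<^sup>2 + 1) powr (q / 2)"
  define M' where "M' = (B\<^sup>2 + 1) powr ((q - 1) / 2)"
  have \<psi>M: "\<bar>\<psi> n x\<bar> \<le> M * indicator (cball 0 (R + 1)) x" for n x
  proof (cases "x \<in> cball 0 (R + 1)")
    case True
    \<comment> \<open>Monotonicity of the power places \<open>\<psi> n x\<close> between 0 and
      \<open>M\<close>.\<close>
    have "((d n)\<^sup>2) powr (q / 2) \<le> u n x powr (q / 2)" "u n x powr (q / 2) \<le> M"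
      unfolding M_def using q uB by (auto intro!: powr_mono2 simp: u_def)
    moreover have "0 \<le> ((d n)\<^sup>2) powr (q / 2)" by simp
    ultimately have "\<bar>\<psi> n x\<bar> \<le> M" unfolding \<psi>_def by linarith
    then show ?thesis using True by simp
  qed (use \<psi>0 in auto)
  have wM: "\<bar>w n x\<bar> \<le> M'" for n x
  proof -
    have "\<bar>w n x\<bar> \<le> u n x powr ((q - 1) / 2)"
      unfolding w_def u_def by (rule regularized_powr_bound)
    also have "\<dots> \<le> M'" unfolding M'_def using q uB by (intro powr_mono2) auto
    finally show ?thesis .
  qed
  have pos: "0 \<le> M" "0 \<le> M'" by (auto simp: M_def M'_def)
  have [measurable]: "partial_deriv (\<psi> n) i \<in> borel_measurable lebesgue" if "i \<in> Basis" for n i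
    using test_fun_partial_deriv[OF \<psi>t that, of n]
    by (auto simp: test_fun_def intro: continuous_imp_measurable_lebesgue smooth_fun_continuous)
  have [measurable]: "\<psi> n \<in> borel_measurable lebesgue" for n
    using \<psi>t[of n] by (auto simp: test_fun_def intro: continuous_imp_measurable_lebesgue smooth_fun_continuous)
  have hdom: "integrable lebesgue (\<lambda>x. M * norm (indicat_real (cball 0 (R + 1)) x *\<^sub>R h x))"
    using h unfolding loc_integrable_def set_integrable_def by (intro integrable_mult_right integrable_norm) auto
  have hlim: "AE x in lebesgue. (\<lambda>n. h x * \<psi> n x) \<longlonglongrightarrow> h x * \<bar>\<phi> x\<bar> powr q"
    using r
  proof eventually_elim
    case (elim x)
    have "(\<lambda>n. u n x powr (q / 2)) \<longlonglongrightarrow> \<bar>\<phi> x\<bar> powr q"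
      unfolding u_def using q by (intro regularized_powr_tendsto lim(1) elim d) auto
    \<comment> \<open>The subtracted constants tend to 0, by the same limit applied to the zero
      sequence.\<close>
    moreover have "(\<lambda>n. (0\<^sup>2 + (d n)\<^sup>2) powr (q / 2)) \<longlonglongrightarrow> \<bar>0\<bar> powr q"
      using q by (intro regularized_powr_tendsto[where a = "\<lambda>n. 0"] d) auto
    ultimately have "(\<lambda>n. \<psi> n x) \<longlonglongrightarrow> \<bar>\<phi> x\<bar> powr q - 0"
      unfolding \<psi>_def by (intro tendsto_diff) auto
    then show ?case by (auto intro: tendsto_mult_left)
  qed
  have hbd: "AE x in lebesgue. norm (h x * \<psi> n x) \<le> M * norm (indicat_real (cball 0 (R + 1)) x *\<^sub>R h x)" for n
    using mult_right_mono[OF \<psi>M abs_ge_zero] by (auto simp: abs_mult mult.commute mult.left_commute)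
  show hint: "integrable lebesgue (\<lambda>x. h x * \<bar>\<phi> x\<bar> powr q)"
    by (rule integrable_dominated_convergence[OF _ _ hdom hlim hbd]) auto
  have hconv: "(\<lambda>n. \<integral>x. h x * \<psi> n x \<partial>lebesgue) \<longlonglongrightarrow> (\<integral>x. h x * \<bar>\<phi> x\<bar> powr q \<partial>lebesgue)"
    by (rule integral_dominated_convergence[OF _ _ hdom hlim hbd]) auto
  define W where "W = (\<lambda>x. q * (\<bar>\<phi> x\<bar> powr (q - 2) * \<phi> x) * (F x \<bullet> \<Phi> x))"
  \<comment> \<open>\<open>M'\<close> bounds \<open>w n\<close> and \<open>C\<close> bounds the
    mollified gradient components; the dimension counts the summands of the inner product.\<close>
  have Fdom: "integrable lebesgue (\<lambda>x. real DIM('a) * (q * M' * C) * norm (indicat_real (cball 0 (R + 1)) x *\<^sub>R F x))"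
    using F unfolding loc_integrable_def set_integrable_def by (intro integrable_mult_right integrable_norm) auto
  have Flim: "AE x in lebesgue. (\<lambda>n. \<Sum>i\<in>Basis. (F x \<bullet> i) * partial_deriv (\<psi> n) i x) \<longlonglongrightarrow> W x"
    using r
  proof eventually_elim
    case (elim x)
    have "(\<lambda>n. w n x) \<longlonglongrightarrow> \<bar>\<phi> x\<bar> powr (q - 2) * \<phi> x"
      unfolding w_def u_def by (intro regularized_powr_deriv_tendsto lim(1) elim d q)
    then have "(\<lambda>n. \<Sum>i\<in>Basis. (F x \<bullet> i) * partial_deriv (\<psi> n) i x)
       \<longlonglongrightarrow> (\<Sum>i\<in>Basis. (F x \<bullet> i) * (q * (\<bar>\<phi> x\<bar> powr (q - 2) * \<phi> x) * (indicat_real (cball 0 (R + 1)) x * D i x)))"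
      unfolding \<psi>D using fD by (auto intro!: tendsto_intros lim(2)[OF elim])
    also have "(\<Sum>i\<in>Basis. (F x \<bullet> i) * (q * (\<bar>\<phi> x\<bar> powr (q - 2) * \<phi> x) * (indicat_real (cball 0 (R + 1)) x * D i x))) = W x"
    \<comment> \<open>Beyond radius \<open>R\<close> both sides vanish with \<open>\<phi> x\<close>;
      within it both cutoffs equal 1 and the sum is the inner product.\<close>
    proof (cases "R < norm x")
      case True
      then show ?thesis using \<phi>0 by (simp add: W_def)
    next
      case False
      then show ?thesis
        by (simp add: W_def D_def euclidean_inner[of "F x" "\<Phi> x"] sum_distrib_left mult_ac)
    qed
    finally show ?case .
  qed
  have Fbd: "AE x in lebesgue. norm (\<Sum>i\<in>Basis. (F x \<bullet> i) * partial_deriv (\<psi> n) i x)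
      \<le> real DIM('a) * (q * M' * C) * norm (indicat_real (cball 0 (R + 1)) x *\<^sub>R F x)" for n
  proof (rule AE_I2)
    fix x
    have "norm (\<Sum>i\<in>Basis. (F x \<bullet> i) * partial_deriv (\<psi> n) i x)
        \<le> (\<Sum>i\<in>(Basis::'a set). (q * M' * C) * norm (indicat_real (cball 0 (R + 1)) x *\<^sub>R F x))"
    proof (rule sum_norm_le)
      fix i :: 'a assume i: "i \<in> Basis"
      have c: "\<bar>conv (D i) (\<rho> (r n)) x\<bar> \<le> C" by (rule conv_bounded[OF Di[OF i] \<rho> DC[OF i]])
      have "norm ((F x \<bullet> i) * partial_deriv (\<psi> n) i x) =
          \<bar>F x \<bullet> i\<bar> * ((q * \<bar>w n x\<bar>) * (indicat_real (cball 0 (R + 1)) x * \<bar>conv (D i) (\<rho> (r n)) x\<bar>))"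
        using q by (simp add: \<psi>D fD[OF i] abs_mult)
      also have "\<dots> \<le> norm (F x) * ((q * M') * (indicat_real (cball 0 (R + 1)) x * C))"
        using wM[of n x] c Basis_le_norm[OF i, of "F x"] q pos
        by (intro mult_mono mult_nonneg_nonneg) auto
      finally show "norm ((F x \<bullet> i) * partial_deriv (\<psi> n) i x)
          \<le> (q * M' * C) * norm (indicat_real (cball 0 (R + 1)) x *\<^sub>R F x)"
        by (simp add: mult_ac)
    qed
    then show "norm (\<Sum>i\<in>Basis. (F x \<bullet> i) * partial_deriv (\<psi> n) i x)
      \<le> real DIM('a) * (q * M' * C) * norm (indicat_real (cball 0 (R + 1)) x *\<^sub>R F x)"
      by simp
  qed
  have Wm: "W \<in> borel_measurable lebesgue" unfolding W_def by measurable
  have Fm': "(\<lambda>x. \<Sum>i\<in>Basis. (F x \<bullet> i) * partial_deriv (\<psi> n) i x) \<in> borel_measurable lebesgue" for n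
    by (intro borel_measurable_sum borel_measurable_times borel_measurable_inner) auto
  show "integrable lebesgue (\<lambda>x. q * (\<bar>\<phi> x\<bar> powr (q - 2) * \<phi> x) * (F x \<bullet> \<Phi> x))"
    using integrable_dominated_convergence[OF Wm Fm' Fdom Flim Fbd] unfolding W_def .
  have "(\<lambda>n. \<integral>x. (\<Sum>i\<in>Basis. (F x \<bullet> i) * partial_deriv (\<psi> n) i x) \<partial>lebesgue) \<longlonglongrightarrow> (\<integral>x. W x \<partial>lebesgue)"
    by (rule integral_dominated_convergence[OF Wm Fm' Fdom Flim Fbd])
  then have "(\<lambda>n. - (\<integral>x. h x * \<psi> n x \<partial>lebesgue)) \<longlonglongrightarrow> (\<integral>x. W x \<partial>lebesgue)"
    using div \<psi>t by simp
  from LIMSEQ_unique[OF this tendsto_minus[OF hconv]]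
  show "(\<integral>x. q * (\<bar>\<phi> x\<bar> powr (q - 2) * \<phi> x) * (F x \<bullet> \<Phi> x) \<partial>lebesgue)
      = - (\<integral>x. h x * \<bar>\<phi> x\<bar> powr q \<partial>lebesgue)"
    unfolding W_def .
qed

section \<open>The weighted inequality\<close>

text \<open>Young's inequality with the conjugate exponents \<open>p = q / (q - 1)\<close> and
  \<open>q\<close>, after moving the weight \<open>k powr (1 / p)\<close> from one factor to the
  other.\<close>

lemma Young_weighted:
  fixes q a m k :: real
  assumes q: "q > 1" and a: "a \<ge> 0" and m: "m \<ge> 0" and k: "k > 0"
  shows "q * a powr (q - 1) * m
    \<le> (1 - 1 / q) * (a powr q * k) + q powr (q - 1) * (m powr q / k powr (q - 1))"
proof -
  define p where "p = q / (q - 1)"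
  \<comment> \<open>Chosen so that \<open>s * b\<close> is the left-hand side and
    \<open>s powr p\<close> is \<open>a powr q * k\<close>, the quantity to be absorbed.\<close>
  define s where "s = a powr (q - 1) * k powr ((q - 1) / q)"
  define b where "b = q * m / k powr ((q - 1) / q)"
  have p: "p > 1" "1 / p + 1 / q = 1" "1 / p = 1 - 1 / q"
    using q by (auto simp: p_def field_simps)
  have "q * a powr (q - 1) * m = s * b"
    using k by (simp add: s_def b_def)
  also have "\<dots> \<le> s powr p / p + b powr q / q"
    using p q a m k by (intro Youngs_inequality) (auto simp: s_def b_def)
  also have "s powr p / p = (1 - 1 / q) * s powr p" by (simp add: p(3)[symmetric])
  also have "s powr p = a powr q * k"
  proof -
    have "(q - 1) * p = q" "(q - 1) / q * p = 1" using q by (auto simp: p_def)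
    then show ?thesis using k by (simp add: s_def powr_mult powr_powr)
  qed
  also have "b powr q / q = q powr (q - 1) * (m powr q / k powr (q - 1))"
    using q m k by (simp add: b_def powr_divide powr_mult powr_powr powr_diff mult_ac)
  finally show ?thesis .
qed

text \<open>For \<open>k = 0 < m\<close> the quotient is \<open>\<infinity>\<close>, and for \<open>k = m = 0\<close> it is \<open>0\<close>.\<close>
lemma Young_weighted_ennreal:
  fixes q a m k :: real
  assumes q: "q > 1" and a: "a \<ge> 0" and m: "m \<ge> 0" and k: "k \<ge> 0"
  shows "ennreal (q * a powr (q - 1) * m)
    \<le> ennreal (1 - 1 / q) * ennreal (a powr q * k)
      + ennreal (q powr (q - 1)) * (ennreal (m powr q) / ennreal (k powr (q - 1)))"
proof (cases "k = 0")
  case True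
  show ?thesis
  proof (cases "m = 0")
    case False
    then have "ennreal (m powr q) / ennreal (k powr (q - 1)) = top"
      using True m by (simp add: ennreal_divide_eq_top_iff)
    then show ?thesis using q by (simp add: ennreal_mult_top)
  qed simp
next
  case False
  then have k: "k > 0" using k by simp
  have "ennreal (1 - 1 / q) * ennreal (a powr q * k)
      + ennreal (q powr (q - 1)) * (ennreal (m powr q) / ennreal (k powr (q - 1)))
    = ennreal ((1 - 1 / q) * (a powr q * k) + q powr (q - 1) * (m powr q / k powr (q - 1)))"
    using q k by (simp add: divide_ennreal ennreal_mult[symmetric] ennreal_plus[symmetric] del: ennreal_plus)
  then show ?thesis
    using Young_weighted[OF q a m k] by (simp add: ennreal_leI)
qed

text \<open>Both integrals are nonnegative extended ones, so the right-hand side may be infinite.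
  Where \<open>h\<close> vanishes, the quotient is 0 if its numerator vanishes too and infinite
  otherwise.\<close>

theorem theorem1p3:
  fixes q \<theta> :: real
    and g :: "'a::euclidean_space \<Rightarrow> real" and G :: "'a \<Rightarrow> 'a" and h :: "'a \<Rightarrow> real"
    and \<phi> :: "'a \<Rightarrow> real" and \<Phi> :: "'a \<Rightarrow> 'a"
  assumes "1 < q" and "1 < \<theta>"
    and "W11_loc g G"
    and "AE x in lebesgue. 0 < g x"
    and "theta_laplacian_is \<theta> G h"
    and "(AE x in lebesgue. 0 \<le> h x) \<or> (AE x in lebesgue. h x \<le> 0)"
    and "W1inf \<phi> \<Phi>"
    and "\<exists>K. compact K \<and> (\<forall>x. x \<notin> K \<longrightarrow> \<phi> x = 0)"
  shows "(\<integral>\<^sup>+x. ennreal (\<bar>\<phi> x\<bar> powr q * \<bar>h x\<bar>) \<partial>lebesgue)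
    \<le> ennreal (q powr q) *
      (\<integral>\<^sup>+x. ennreal (norm (\<Phi> x) powr q * norm (G x) powr (q * (\<theta> - 1)))
                / ennreal (\<bar>h x\<bar> powr (q - 1)) \<partial>lebesgue)"
proof -
  define F where "F = (\<lambda>x. (norm (G x) powr (\<theta> - 2)) *\<^sub>R G x)"
  obtain K where K: "compact K" "\<forall>x. x \<notin> K \<longrightarrow> \<phi> x = 0" using assms(8) by blast
  have F: "loc_integrable F" and h: "loc_integrable h"
    using assms(5) by (auto simp: theta_laplacian_is_def F_def)
  have div: "\<forall>\<psi>. test_fun \<psi> \<longrightarrow>
      (\<integral>x. (\<Sum>i\<in>Basis. (F x \<bullet> i) * partial_deriv \<psi> i x) \<partial>lebesgue) = - (\<integral>x. h x * \<psi> x \<partial>lebesgue)"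
    using assms(5) by (simp add: theta_laplacian_is_def F_def sum_distrib_left mult.assoc)
  note id = weak_divergence_powr[OF assms(1) F h div assms(7) K]
  have [measurable]: "G \<in> borel_measurable lebesgue" "\<Phi> \<in> borel_measurable lebesgue"
    "h \<in> borel_measurable lebesgue" "\<phi> \<in> borel_measurable lebesgue"
    using assms(3,7) h
    by (auto simp: W11_loc_def weak_gradient_def W1inf_def ess_bounded_def intro: loc_integrable_measurable)
  define Q where "Q x = ennreal (norm (\<Phi> x) powr q * norm (G x) powr (q * (\<theta> - 1))) / ennreal (\<bar>h x\<bar> powr (q - 1))" for x
  define I where "I = (\<integral>x. \<bar>\<phi> x\<bar> powr q * \<bar>h x\<bar> \<partial>lebesgue)"
  have int: "integrable lebesgue (\<lambda>x. \<bar>\<phi> x\<bar> powr q * \<bar>h x\<bar>)"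
    using integrable_norm[OF id(1)] by (simp add: abs_mult mult.commute)
  have "I \<ge> 0" by (simp add: I_def)
  have A: "(\<integral>\<^sup>+x. ennreal (\<bar>\<phi> x\<bar> powr q * \<bar>h x\<bar>) \<partial>lebesgue) = ennreal I"
    unfolding I_def using int by (intro nn_integral_eq_integral) auto
  \<comment> \<open>This is where the constant sign enters: no cancellation occurs, so the modulus
    of the integral is the integral of the modulus.\<close>
  have sgn: "\<bar>\<integral>x. h x * \<bar>\<phi> x\<bar> powr q \<partial>lebesgue\<bar> = I"
    using assms(6)
  proof
    assume "AE x in lebesgue. 0 \<le> h x"
    then have "(\<integral>x. h x * \<bar>\<phi> x\<bar> powr q \<partial>lebesgue) = I"
      unfolding I_def by (intro integral_cong_AE) (auto elim!: eventually_mono)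
    then show ?thesis using \<open>I \<ge> 0\<close> by simp
  next
    assume "AE x in lebesgue. h x \<le> 0"
    then have "(\<integral>x. - (h x * \<bar>\<phi> x\<bar> powr q) \<partial>lebesgue) = I"
      unfolding I_def by (intro integral_cong_AE) (auto elim!: eventually_mono)
    then show ?thesis using \<open>I \<ge> 0\<close> by simp
  qed
  have pointwise: "ennreal (norm (q * (\<bar>\<phi> x\<bar> powr (q - 2) * \<phi> x) * (F x \<bullet> \<Phi> x)))
      \<le> ennreal (1 - 1 / q) * ennreal (\<bar>\<phi> x\<bar> powr q * \<bar>h x\<bar>) + ennreal (q powr (q - 1)) * Q x" for x
  proof -
    define m where "m = norm (\<Phi> x) * norm (G x) powr (\<theta> - 1)"
    have "0 \<le> m" by (simp add: m_def)
    have mq: "m powr q = norm (\<Phi> x) powr q * norm (G x) powr (q * (\<theta> - 1))"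
      by (simp add: m_def powr_mult powr_powr mult.commute)
    \<comment> \<open>Also true where \<open>G x = 0\<close>, since \<open>0 powr\<close> any
      exponent is 0.\<close>
    have "norm (F x) = norm (G x) powr (\<theta> - 1)"
      by (cases "G x = 0") (auto simp: F_def powr_diff power2_eq_square powr_numeral)
    then have "\<bar>F x \<bullet> \<Phi> x\<bar> \<le> m"
      using Cauchy_Schwarz_ineq2[of "F x" "\<Phi> x"] by (simp add: m_def mult.commute)
    moreover have "\<bar>\<bar>\<phi> x\<bar> powr (q - 2) * \<phi> x\<bar> = \<bar>\<phi> x\<bar> powr (q - 1)"
      by (cases "\<phi> x = 0") (auto simp: abs_mult powr_diff power2_eq_square powr_numeral)
    ultimately have "norm (q * (\<bar>\<phi> x\<bar> powr (q - 2) * \<phi> x) * (F x \<bullet> \<Phi> x)) \<le> q * \<bar>\<phi> x\<bar> powr (q - 1) * m"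
      using assms(1) by (simp add: abs_mult[of "q * _"] abs_mult[of q] mult_left_mono)
    then have "ennreal (norm (q * (\<bar>\<phi> x\<bar> powr (q - 2) * \<phi> x) * (F x \<bullet> \<Phi> x))) \<le> ennreal (q * \<bar>\<phi> x\<bar> powr (q - 1) * m)"
      by (rule ennreal_leI)
    also have "\<dots> \<le> ennreal (1 - 1 / q) * ennreal (\<bar>\<phi> x\<bar> powr q * \<bar>h x\<bar>) + ennreal (q powr (q - 1)) * Q x"
      using Young_weighted_ennreal[OF assms(1), of "\<bar>\<phi> x\<bar>" m "\<bar>h x\<bar>"] \<open>0 \<le> m\<close> by (simp add: Q_def mq)
    finally show ?thesis .
  qed
  have [measurable]: "Q \<in> borel_measurable lebesgue" unfolding Q_def by measurable
  have "ennreal I \<le> (\<integral>\<^sup>+x. ennreal (norm (q * (\<bar>\<phi> x\<bar> powr (q - 2) * \<phi> x) * (F x \<bullet> \<Phi> x))) \<partial>lebesgue)"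
    using integral_norm_bound_ennreal[OF id(2)] unfolding id(3) by (simp add: sgn)
  also have "\<dots> \<le> (\<integral>\<^sup>+x. ennreal (1 - 1 / q) * ennreal (\<bar>\<phi> x\<bar> powr q * \<bar>h x\<bar>) + ennreal (q powr (q - 1)) * Q x \<partial>lebesgue)"
    by (intro nn_integral_mono pointwise)
  also have "\<dots> = ennreal (1 - 1 / q) * ennreal I + ennreal (q powr (q - 1)) * (\<integral>\<^sup>+x. Q x \<partial>lebesgue)"
    by (simp add: nn_integral_add nn_integral_cmult A)
  finally have main: "ennreal I \<le> ennreal (1 - 1 / q) * ennreal I + ennreal (q powr (q - 1)) * (\<integral>\<^sup>+x. Q x \<partial>lebesgue)" .
  \<comment> \<open>Since \<open>I\<close> is finite, \<open>(1 - 1 / q) * I\<close> can be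
    subtracted; multiplying the remaining \<open>I / q\<close> by \<open>q\<close> turns
    \<open>q powr (q - 1)\<close> into \<open>q powr q\<close>. If the integral of \<open>Q\<close>
    is infinite, so is the right-hand side.\<close>
  have "ennreal I \<le> ennreal (q powr q) * (\<integral>\<^sup>+x. Q x \<partial>lebesgue)"
  proof (cases "\<integral>\<^sup>+x. Q x \<partial>lebesgue")
    case (real J)
    have "ennreal I \<le> ennreal ((1 - 1 / q) * I + q powr (q - 1) * J)"
      using main real \<open>I \<ge> 0\<close> assms(1)
      by (simp add: ennreal_mult[symmetric] ennreal_plus[symmetric] del: ennreal_plus)
    then have "I \<le> (1 - 1 / q) * I + q powr (q - 1) * J"
      using real \<open>I \<ge> 0\<close> assms(1) by (subst (asm) ennreal_le_iff) auto
    then have "I \<le> q * q powr (q - 1) * J"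
      using assms(1) by (simp add: field_simps)
    also have "q * q powr (q - 1) = q powr q"
      using assms(1) by (simp add: powr_diff)
    finally show ?thesis
      using real by (simp add: ennreal_mult[symmetric] ennreal_leI)
  next
    case top
    then show ?thesis using assms(1) by (simp add: ennreal_mult_top)
  qed
  then show ?thesis unfolding A Q_def .
qed

end
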